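(* Each of the following groups (under composition) is invariably generated: (1) the group $\mathrm{PP}_+(\mathbb{R})$ of piecewise projective homeomorphisms of the real line; (2) the group of piecewise $\mathrm{PSL}(2,\mathbb{Z})$ homeomorphisms of the real line; (3) Monod's group $H(\mathbb{Z})$, i.e. the group of piecewise $\mathrm{PSL}(2,\mathbb{Z})$ homeomorphisms of the real line all of whose breakpoints lie in $P_{\mathbb{Z}} = \{x \in \mathbb{R} : \text{there is a hyperbolic element } A \in \mathrm{PSL}(2,\mathbb{Z}) \text{ with } Ax = x\}$; (4) the group of piecewise $\mathrm{PSL}(2,\mathbb{Q})$ homeomorphisms of the real line all of whose breakpoints are rational.
   Context: A group $G$ is invariably generated if for every map $\chi\colon G \to G$ the set $\{\chi(g)\, g\, \chi(g)^{-1} : g \in G\}$ generates $G$. (Equivalently, no proper subgroup of $G$ meets every conjugacy class of $G$.) $\mathrm{PSL}(2,\mathbb{R})$ acts on $\mathbb{R}P^1 = \mathbb{R}\cup\{\infty\}$ by Möbius transformations. A homeomorphism $f$ of $\mathbb{R}P^1$ is piecewise projective if $\mathbb{R}P^1$ is covered by finitely many closed intervals such that the restriction of $f$ to each of them coincides with the Möbius transformation of some element of $\mathrm{PSL}(2,\mathbb{R})$. If moreover $f(\infty)=\infty$, the restriction $f|_{\mathbb{R}}$ is called a piecewise projective homeomorphism of the real line; $\mathrm{PP}_+(\mathbb{R})$ is the group of all of these. For a subgroup $K$ of $\mathrm{PSL}(2,\mathbb{R})$, an element of $\mathrm{PP}_+(\mathbb{R})$ is a piecewise $K$ homeomorphism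 of the real line if the finitely many intervals can be chosen so that on each of them the map is the Möbius transformation of an element of $K$. A breakpoint of $f$ is a point of $\mathbb{R}$ having no neighbourhood on which $f$ coincides with a single Möbius transformation. An element of $\mathrm{PSL}(2,\mathbb{Z})$ is hyperbolic if the absolute value of its trace is greater than $2$. *)

theory Defs
  imports "HOL-Analysis.Analysis" "HOL-Algebra.Algebra"
begin

definition invariably_generated :: "('g, 'm) monoid_scheme \<Rightarrow> bool" where
  "invariably_generated G \<longleftrightarrow>
     group G \<and>
     (\<forall>c \<in> carrier G \<rightarrow> carrier G.
        generate G {c g \<otimes>\<^bsub>G\<^esub> g \<otimes>\<^bsub>G\<^esub> inv\<^bsub>G\<^esub> (c g) | g. g \<in> carrier G} = carrier G)"


subsection \<open>The groups PSL(2,R), PSL(2,Q), PSL(2,Z)\<close>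

text \<open>The coefficient ring is given by its carrier, a subring of the reals. The elements of
  \<open>PSL2 R\<close> are the cosets \<open>{A, -A}\<close>, so that \<open>PSL2 \<int>\<close> and \<open>PSL2 \<rat>\<close> are literally contained in
  \<open>PSL2 \<real>\<close>.\<close>

definition SL2 :: "real set \<Rightarrow> (real^2^2) monoid" where
  "SL2 R = \<lparr>carrier = {A. (\<forall>i j. A $ i $ j \<in> R) \<and> det A = 1}, mult = (**), one = mat 1\<rparr>"

definition PSL2 :: "real set \<Rightarrow> (real^2^2) set monoid" where
  "PSL2 R = SL2 R Mod {mat 1, - mat 1}"

lemma carrier_PSL2: "carrier (PSL2 R) = {{A, - A} | A. A \<in> carrier (SL2 R)}"
proof -
  have neg: "(- mat 1) ** A = - A" for A :: "real^2^2"
    by (simp add: vec_eq_iff matrix_matrix_mult_def mat_def sum_2 forall_2)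
  show ?thesis
    by (auto simp: PSL2_def FactGroup_def RCOSETS_def r_coset_def SL2_def neg)
qed

definition hyperbolic :: "(real^2^2) set \<Rightarrow> bool" where
  "hyperbolic P \<longleftrightarrow> (\<forall>A\<in>P. \<bar>trace A\<bar> > 2)"


subsection \<open>The action on the projective line\<close>

text \<open>The point at infinity is \<open>None\<close>.\<close>

abbreviation RP1 :: "real option topology" where
  "RP1 \<equiv> Alexandroff_compactification euclidean"

definition mobius_mat :: "real^2^2 \<Rightarrow> real option \<Rightarrow> real option" where
  "mobius_mat A p =
     (case p of
        None \<Rightarrow> if A$2$1 = 0 then None else Some (A$1$1 / A$2$1)
      | Some x \<Rightarrow> if A$2$1 * x + A$2$2 = 0 then None
                  else Some ((A$1$1 * x + A$1$2) / (A$2$1 * x + A$2$2)))"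

definition mobius :: "(real^2^2) set \<Rightarrow> real option \<Rightarrow> real option" where
  "mobius P = the_elem (mobius_mat ` P)"

lemma mobius_mat_uminus: "mobius_mat (- A) = mobius_mat A"
proof
  fix p
  have neg: "(- a) * x + (- b) = - (a * x + b)" for a b x :: real
    by simp
  show "mobius_mat (- A) p = mobius_mat A p"
    unfolding mobius_mat_def vector_uminus_component neg
    by (simp only: neg_equal_0_iff_equal minus_divide_divide)
qed

lemma mobius_coset: "mobius {A, - A} = mobius_mat A"
  by (simp add: mobius_def mobius_mat_uminus)


subsection \<open>Piecewise projective homeomorphisms\<close>

text \<open>The closed intervals of the projective line are its closed connected subsets. These include
  degenerate ones (single points), which make no difference in a finite cover: the projective line
  has no isolated points, so the nondegenerate members already cover it.\<close>

definition closed_interval_RP1 :: "real option set \<Rightarrow> bool" where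
  "closed_interval_RP1 I \<longleftrightarrow> closedin RP1 I \<and> connectedin RP1 I"

definition piecewise_mobius :: "(real^2^2) set set \<Rightarrow> (real option \<Rightarrow> real option) \<Rightarrow> bool" where
  "piecewise_mobius K f \<longleftrightarrow>
     (\<exists>\<I>. finite \<I> \<and> (\<forall>I\<in>\<I>. closed_interval_RP1 I) \<and> \<Union>\<I> = topspace RP1 \<and>
          (\<forall>I\<in>\<I>. \<exists>P\<in>K. \<forall>p\<in>I. f p = mobius P p))"

definition piecewise_homeos :: "(real^2^2) set set \<Rightarrow> (real \<Rightarrow> real) set" where
  "piecewise_homeos K =
     {h. \<exists>f. homeomorphic_map RP1 RP1 f \<and> piecewise_mobius K f \<and>
             f None = None \<and> (\<forall>x. f (Some x) = Some (h x))}"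

definition breakpoint :: "(real \<Rightarrow> real) \<Rightarrow> real \<Rightarrow> bool" where
  "breakpoint h x \<longleftrightarrow>
     \<not> (\<exists>U. open U \<and> x \<in> U \<and>
            (\<exists>P\<in>carrier (PSL2 \<real>). \<forall>y\<in>U. Some (h y) = mobius P (Some y)))"

definition P_Z :: "real set" where
  "P_Z = {x. \<exists>P\<in>carrier (PSL2 \<int>). hyperbolic P \<and> mobius P (Some x) = Some x}"

definition comp_group :: "('a \<Rightarrow> 'a) set \<Rightarrow> ('a \<Rightarrow> 'a) monoid" where
  "comp_group S = \<lparr>carrier = S, mult = (\<circ>), one = id\<rparr>"

definition PP_plus :: "(real \<Rightarrow> real) monoid" where
  "PP_plus = comp_group (piecewise_homeos (carrier (PSL2 \<real>)))"

definition PPSL2_Z :: "(real \<Rightarrow> real) monoid" where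
  "PPSL2_Z = comp_group (piecewise_homeos (carrier (PSL2 \<int>)))"

definition Monod_H_Z :: "(real \<Rightarrow> real) monoid" where
  "Monod_H_Z =
     comp_group {h \<in> piecewise_homeos (carrier (PSL2 \<int>)). \<forall>x. breakpoint h x \<longrightarrow> x \<in> P_Z}"

definition PPSL2_Q_rational_breaks :: "(real \<Rightarrow> real) monoid" where
  "PPSL2_Q_rational_breaks =
     comp_group {h \<in> piecewise_homeos (carrier (PSL2 \<rat>)). \<forall>x. breakpoint h x \<longrightarrow> x \<in> \<rat>}"

end

theory Submission
  imports Defs
begin

text \<open>
  Let \<open>G\<close> be one of the four groups and let \<open>H\<close> be a subgroup that meets every conjugacy class. The
  claim is \<open>H = G\<close>. As \<open>H\<close> may be replaced by a conjugate, it may be assumed to contain the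
  translation \<open>T x = x + 1\<close> itself.

  The main point is that every germ of every element of \<open>G\<close> is the germ of an element of \<open>H\<close>
  (\<open>good_G\<close>). Given \<open>\<gamma> \<in> G\<close> and a point \<open>x\<close>, there is an element \<open>g\<close> of \<open>G\<close> that is \<open>T\<close> to the left
  of \<open>x - 1\<close>, is \<open>\<gamma>\<close> followed by an integer translation near \<open>x\<close>, and is \<open>T\<close> again from the image of
  \<open>x\<close> onwards; thus a large power of \<open>g\<close> carries points near \<open>x - N\<close> to \<open>+\<infinity>\<close> by applying \<open>\<gamma>\<close> exactly
  once among integer translations. Some conjugate \<open>\<theta> g \<theta>\<inverse>\<close> lies in \<open>H\<close>. Nothing is known about \<open>\<theta>\<close>,
  but near \<open>-\<infinity>\<close> and near \<open>+\<infinity>\<close> it is affine. Hence the power of \<open>\<theta> g \<theta>\<inverse>\<close> has the germ of \<open>\<gamma>\<close> at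
  \<open>x\<close> up to affine maps on both sides, and these can be removed once all germs of affine maps are
  known to come from \<open>H\<close> (\<open>good_affine\<close>). The latter holds because the group of germs at infinity
  consists of the maps \<open>s y + b\<close> with \<open>s\<close> the square of a unit, in which a subgroup meeting all
  conjugacy classes is easily seen to be everything (\<open>all_affine_germs\<close>), and because \<open>T \<in> H\<close> moves
  each point to a neighbourhood of \<open>+\<infinity>\<close>.

  Next, local agreement is turned into agreement on compact intervals (\<open>H_approximates\<close>). If \<open>k \<in> H\<close>
  is the identity on \<open>[u, v]\<close>, then conjugating \<open>k\<close> by an element of \<open>H\<close> that fixes everything to the
  right of some point of \<open>(u, v)\<close> and pushes a far away point into \<open>(u, v)\<close> makes \<open>k\<close> trivial on the
  left without changing it on the right (\<open>H_cut\<close>). So elements of \<open>H\<close> that agree with \<open>\<gamma>\<close> on overlapping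
  intervals can be glued.

  If \<open>g \<in> G\<close> has compact support, then \<open>\<gamma> g \<gamma>\<inverse> \<in> H\<close> for some \<open>\<gamma>\<close>, and if \<open>h \<in> H\<close> agrees with \<open>\<gamma>\<close> on
  the support, then \<open>g = h\<inverse> (\<gamma> g \<gamma>\<inverse>) h \<in> H\<close>. As \<open>H\<close> realises all germs at \<open>-\<infinity>\<close> and, with
  trivial germ at \<open>-\<infinity>\<close>, all germs at \<open>+\<infinity>\<close>, each element of \<open>G\<close> differs from one of \<open>H\<close> by an element
  of compact support.

  The elements of \<open>G\<close> used above are all obtained by following one element up to a point, a single
  Moebius map for a while, and another element from then on (\<open>connect\<close>). That such a connecting
  Moebius map exists, with admissible breakpoints, is the one step that depends on which of the four
  groups is considered. For \<open>\<rat>\<close> and \<open>\<real>\<close> it can be written down (\<open>bridge_field\<close>). For \<open>\<int>\<close> it is found among the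
  maps \<open>M\<^sub>1 T\<^sup>n M\<^sub>2\<close> with large \<open>n\<close>, whose graphs are nearly a vertical line followed by a nearly
  horizontal one; they cross the two graphs to be connected at fixed points of hyperbolic
  elements (\<open>bridge_int\<close>).
\<close>

section \<open>Moebius maps on the real line\<close>

text \<open>Off its pole, a Moebius map is treated as a function on the reals: \<open>den A x \<noteq> 0\<close> says that \<open>x\<close> is
  not the pole, and at the pole \<open>mob A\<close> has the meaningless value \<open>0\<close>.\<close>

definition den :: "real^2^2 \<Rightarrow> real \<Rightarrow> real" where
  "den A x = A$2$1 * x + A$2$2"

definition mob :: "real^2^2 \<Rightarrow> real \<Rightarrow> real" where
  "mob A x = (A$1$1 * x + A$1$2) / den A x"

definition matrix_2x2 :: "real \<Rightarrow> real \<Rightarrow> real \<Rightarrow> real \<Rightarrow> real^2^2" where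
  "matrix_2x2 a b c d = vector [vector [a, b], vector [c, d]]"

abbreviation sl :: "real set \<Rightarrow> (real^2^2) set" where
  "sl K \<equiv> carrier (SL2 K)"

lemma matrix_2x2_nth [simp]:
  "matrix_2x2 a b c d $ 1 $ 1 = a" "matrix_2x2 a b c d $ 1 $ 2 = b"
  "matrix_2x2 a b c d $ 2 $ 1 = c" "matrix_2x2 a b c d $ 2 $ 2 = d"
  by (simp_all add: matrix_2x2_def)

lemma sl_iff:
  "A \<in> sl K \<longleftrightarrow> A$1$1 \<in> K \<and> A$1$2 \<in> K \<and> A$2$1 \<in> K \<and> A$2$2 \<in> K \<and>
     A$1$1 * A$2$2 - A$1$2 * A$2$1 = 1"
  by (auto simp: SL2_def det_2 forall_2)

lemma matrix_mult_nth_2: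
  fixes A B :: "real^2^2"
  shows "(A ** B) $ i $ j = A$i$1 * B$1$j + A$i$2 * B$2$j"
  by (simp add: matrix_matrix_mult_def sum_2)

text \<open>The adjugate matrix; it represents the inverse Moebius map when the determinant is one.\<close>

definition adj :: "real^2^2 \<Rightarrow> real^2^2" where
  "adj A = matrix_2x2 (A$2$2) (- A$1$2) (- A$2$1) (A$1$1)"

lemma mob_Some: "mobius_mat A (Some x) = (if den A x = 0 then None else Some (mob A x))"
  by (simp add: mobius_mat_def den_def mob_def)

lemma den_mult: "den A x \<noteq> 0 \<Longrightarrow> den (B ** A) x = den B (mob A x) * den A x"
  by (simp add: den_def mob_def matrix_mult_nth_2 field_simps)

lemma mob_mult:
  assumes "den A x \<noteq> 0"
  shows "mob (B ** A) x = mob B (mob A x)"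
proof -
  have "(B ** A)$1$1 * x + (B ** A)$1$2 = (B$1$1 * mob A x + B$1$2) * den A x"
    using assms by (simp add: den_def mob_def matrix_mult_nth_2 field_simps)
  then show ?thesis
    using assms by (simp add: mob_def [of "B ** A"] mob_def [of B] den_mult)
qed

lemma den_adj_mob:
  assumes "A \<in> sl K" "den A x \<noteq> 0"
  shows "den (adj A) (mob A x) * den A x = 1"
proof -
  have "den (adj A) (mob A x) * den A x = - A$2$1 * (A$1$1 * x + A$1$2) + A$1$1 * den A x"
    using assms(2) by (simp add: den_def [of "matrix_2x2 _ _ _ _"] adj_def mob_def field_simps)
  also have "\<dots> = 1"
    using assms(1) by (simp add: sl_iff den_def algebra_simps)
  finally show ?thesis .
qed

lemma mob_adj_mob:
  assumes "A \<in> sl K" "den A x \<noteq> 0"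
  shows "mob (adj A) (mob A x) = x"
proof -
  have 1: "den (adj A) (mob A x) = 1 / den A x"
    using den_adj_mob [OF assms] assms(2) by (simp add: field_simps)
  have "(A$2$2 * mob A x - A$1$2) * den A x = A$2$2 * (A$1$1 * x + A$1$2) - A$1$2 * den A x"
    using assms(2) by (simp add: mob_def field_simps)
  also have "\<dots> = x * (A$1$1 * A$2$2 - A$1$2 * A$2$1)"
    by (simp add: den_def algebra_simps)
  also have "\<dots> = x" using assms(1) by (simp add: sl_iff)
  finally show ?thesis
    using 1 by (simp add: mob_def [of "adj A"]) (simp add: adj_def algebra_simps)
qed

lemma mob_diff:
  assumes "A \<in> sl K" "den A x \<noteq> 0" "den A y \<noteq> 0"
  shows "mob A y - mob A x = (y - x) / (den A x * den A y)"
proof -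
  have "(A$1$1 * y + A$1$2) * den A x - (A$1$1 * x + A$1$2) * den A y
      = (y - x) * (A$1$1 * A$2$2 - A$1$2 * A$2$1)"
    by (simp add: den_def algebra_simps)
  then have "(A$1$1 * y + A$1$2) * den A x - (A$1$1 * x + A$1$2) * den A y = y - x"
    using assms(1) by (simp add: sl_iff)
  then show ?thesis
    using assms(2,3) unfolding mob_def by (simp add: diff_frac_eq mult.commute)
qed

lemma mob_less:
  assumes "A \<in> sl K" "x < y" "den A x * den A y > 0"
  shows "mob A x < mob A y"
proof -
  have "mob A y - mob A x = (y - x) / (den A x * den A y)"
    using assms(3) by (intro mob_diff [OF assms(1)]) auto
  also have "\<dots> > 0" using assms by simp
  finally show ?thesis by simp
qed

lemma continuous_den [continuous_intros]:
  "continuous F f \<Longrightarrow> continuous F (\<lambda>x. den A (f x))"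
  unfolding den_def by (intro continuous_intros)

lemma isCont_mob: "den A x \<noteq> 0 \<Longrightarrow> isCont (mob A) x"
  unfolding mob_def [abs_def] by (intro continuous_intros) 

lemma eventually_den:
  assumes "den A x \<noteq> 0" shows "\<forall>\<^sub>F y in nhds x. den A y * den A x > 0"
proof -
  have "((\<lambda>y. den A y * den A x) \<longlongrightarrow> den A x * den A x) (nhds x)"
    unfolding den_def by (intro tendsto_intros filterlim_ident)
  then show ?thesis
    by (rule order_tendstoD(1)) (use assms in \<open>auto simp: zero_less_mult_iff\<close>)
qed

lemma eventually_den_nonzero:
  assumes "den A x \<noteq> 0" "F \<le> nhds x" shows "\<forall>\<^sub>F y in F. den A y \<noteq> 0"
  using filter_leD [OF assms(2) eventually_den [OF assms(1)]] by eventually_elim auto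

lemma at_side_le_nhds: "at_left x \<le> nhds x" "at_right x \<le> nhds (x::real)"
  by (auto simp: at_within_def)

section \<open>Piecewise projective homeomorphisms through their germs\<close>

text \<open>The slopes of the affine maps in \<open>PSL(2, K)\<close>: the matrix with diagonal \<open>a\<close>, \<open>a\<inverse>\<close> and lower
  left entry \<open>0\<close> acts with slope \<open>a\<^sup>2\<close>.\<close>

definition sq_units :: "real set \<Rightarrow> real set" where
  "sq_units K = {a\<^sup>2 | a. a \<in> K \<and> inverse a \<in> K \<and> a \<noteq> 0}"

text \<open>The filter \<open>F\<close> is one of \<open>nhds x\<close>, \<open>at_left x\<close>, \<open>at_right x\<close>. The value at \<open>x\<close> is part of the
  germ, so that germs can be composed and inverted one side at a time.\<close>

definition germ :: "real set \<Rightarrow> real filter \<Rightarrow> real \<Rightarrow> (real \<Rightarrow> real) \<Rightarrow> bool" where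
  "germ K F x h \<longleftrightarrow> (\<exists>A\<in>sl K. den A x \<noteq> 0 \<and> h x = mob A x \<and> (\<forall>\<^sub>F y in F. h y = mob A y))"

definition affine_at :: "real set \<Rightarrow> real filter \<Rightarrow> (real \<Rightarrow> real) \<Rightarrow> bool" where
  "affine_at K F h \<longleftrightarrow> (\<exists>s\<in>sq_units K. \<exists>b\<in>K. \<forall>\<^sub>F y in F. h y = s * y + b)"

text \<open>A purely local description of the homeomorphisms whose pieces come from \<open>PSL(2, K)\<close> and whose
  breakpoints lie in \<open>P\<close>. Finiteness of the set of pieces is encoded by the germs at all points of
  the compact line \<open>\<real> \<union> {\<infinity>}\<close>; membership can then be checked one point at a time.\<close>

definition PW :: "real set \<Rightarrow> real set \<Rightarrow> (real \<Rightarrow> real) set" where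
  "PW K P = {h. strict_mono h \<and> surj h \<and>
     (\<forall>x. germ K (at_left x) x h \<and> germ K (at_right x) x h \<and>
          (x \<notin> P \<longrightarrow> germ K (nhds x) x h)) \<and>
     affine_at K at_top h \<and> affine_at K at_bot h}"

text \<open>The inverse function, whose usual notation is taken by inverses in groups.\<close>

abbreviation finv :: "(real \<Rightarrow> real) \<Rightarrow> real \<Rightarrow> real" where
  "finv \<equiv> inv_into UNIV"

lemma sq_unitsD:
  assumes "s \<in> sq_units K" shows "s > 0"
  using assms by (auto simp: sq_units_def)

lemma continuous_strict_mono_surj:
  fixes h :: "real \<Rightarrow> real"
  assumes "strict_mono h" "surj h"
  shows "isCont h x"
proof -
  have "continuous_on UNIV h"
  proof (rule continuous_onI_mono)
    show "open (h ` UNIV)" using assms(2) by simp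
    show "h x \<le> h y" if "x \<le> y" for x y
      using assms(1) that by (simp add: strict_mono_less_eq)
  qed
  then show ?thesis by (simp add: continuous_on_eq_continuous_at)
qed

lemma strict_mono_inv:
  fixes h :: "real \<Rightarrow> real"
  assumes "strict_mono h" "surj h"
  shows "strict_mono (finv h)" "surj (finv h)" 
proof -
  show "strict_mono (finv h)"
  proof (rule strict_monoI)
    fix x y :: real assume "x < y"
    then have "h (finv h x) < h (finv h y)"
      using assms(2) by (simp add: surj_f_inv_f)
    then show "finv h x < finv h y"
      using assms(1) by (simp add: strict_mono_less)
  qed
  show "surj (finv h)"
    using strict_mono_imp_inj_on [OF assms(1)] by (rule inj_imp_surj_inv)
qed

lemma filterlim_strict_mono_surj:
  fixes h :: "real \<Rightarrow> real"
  assumes "strict_mono h" "surj h"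
  shows "filterlim h (nhds (h x)) (nhds x)"
    "filterlim h (at_right (h x)) (at_right x)" "filterlim h (at_left (h x)) (at_left x)"
    "filterlim h at_top at_top" "filterlim h at_bot at_bot"
proof -
  note c = continuous_strict_mono_surj [OF assms, of x]
  show "filterlim h (nhds (h x)) (nhds x)"
    using c by (simp add: isCont_def tendsto_at_iff_tendsto_nhds)
  show "filterlim h (at_right (h x)) (at_right x)"
    unfolding filterlim_at
  proof
    show "\<forall>\<^sub>F y in at_right x. h y \<in> {h x<..} \<and> h y \<noteq> h x"
      using assms(1) by (auto simp: eventually_at_filter strict_mono_less strict_mono_eq)
    show "(h \<longlongrightarrow> h x) (at_right x)"
      using c by (simp add: isCont_def filterlim_at_split)
  qed
  show "filterlim h (at_left (h x)) (at_left x)"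
    unfolding filterlim_at
  proof
    show "\<forall>\<^sub>F y in at_left x. h y \<in> {..<h x} \<and> h y \<noteq> h x"
      using assms(1) by (auto simp: eventually_at_filter strict_mono_less strict_mono_eq)
    show "(h \<longlongrightarrow> h x) (at_left x)"
      using c by (simp add: isCont_def filterlim_at_split)
  qed
  show "filterlim h at_top at_top"
    unfolding filterlim_at_top
  proof
    fix Z obtain N where "Z = h N" using assms(2) by auto
    then show "\<forall>\<^sub>F x in at_top. Z \<le> h x"
      using assms(1) by (auto simp: eventually_at_top_linorder strict_mono_less_eq)
  qed
  show "filterlim h at_bot at_bot"
    unfolding filterlim_at_bot
  proof
    fix Z obtain N where "Z = h N" using assms(2) by auto
    then show "\<forall>\<^sub>F x in at_bot. h x \<le> Z"
      using assms(1) by (auto simp: eventually_at_bot_linorder strict_mono_less_eq)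
  qed
qed

locale subring_of_reals =
  fixes K :: "real set"
  assumes K_0 [simp]: "0 \<in> K" and K_1 [simp]: "1 \<in> K"
    and K_add: "a \<in> K \<Longrightarrow> b \<in> K \<Longrightarrow> a + b \<in> K"
    and K_mult: "a \<in> K \<Longrightarrow> b \<in> K \<Longrightarrow> a * b \<in> K"
    and K_uminus: "a \<in> K \<Longrightarrow> - a \<in> K"
begin

lemma K_diff: "a \<in> K \<Longrightarrow> b \<in> K \<Longrightarrow> a - b \<in> K"
  using K_add [of a "- b"] K_uminus by simp

lemma K_of_nat: "of_nat n \<in> K"
  by (induction n) (auto intro: K_add)

lemma K_of_int: "of_int n \<in> K"
  by (cases n) (auto simp del: of_nat_Suc intro: K_of_nat K_uminus)

lemma sl_mult:
  assumes "A \<in> sl K" "B \<in> sl K" shows "A ** B \<in> sl K"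
proof -
  have "det (A ** B) = 1" using assms by (simp add: det_mul SL2_def)
  moreover have "(A ** B) $ i $ j \<in> K" for i j
    using assms by (auto simp: matrix_mult_nth_2 SL2_def intro!: K_add K_mult)
  ultimately show ?thesis by (simp add: SL2_def)
qed

lemma sl_adj: "A \<in> sl K \<Longrightarrow> adj A \<in> sl K"
  by (simp add: sl_iff adj_def K_uminus mult.commute)

lemma sq_units_1: "1 \<in> sq_units K"
  by (auto simp: sq_units_def intro: exI [of _ 1])

lemma sq_units_mult: "s \<in> sq_units K \<Longrightarrow> t \<in> sq_units K \<Longrightarrow> s * t \<in> sq_units K"
proof -
  assume "s \<in> sq_units K" "t \<in> sq_units K"
  then obtain a b where "s = a\<^sup>2" "a \<in> K" "inverse a \<in> K" "a \<noteq> 0"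
    "t = b\<^sup>2" "b \<in> K" "inverse b \<in> K" "b \<noteq> 0"
    by (auto simp: sq_units_def)
  then have "s * t = (a * b)\<^sup>2 \<and> a * b \<in> K \<and> inverse (a * b) \<in> K \<and> a * b \<noteq> 0"
    by (auto simp: power_mult_distrib intro: K_mult)
  then show ?thesis unfolding sq_units_def by blast
qed

lemma sq_units_inverse: "s \<in> sq_units K \<Longrightarrow> inverse s \<in> sq_units K"
proof -
  assume "s \<in> sq_units K"
  then obtain a where "s = a\<^sup>2" "a \<in> K" "inverse a \<in> K" "a \<noteq> 0"
    by (auto simp: sq_units_def)
  then have "inverse s = (inverse a)\<^sup>2 \<and> inverse a \<in> K \<and> inverse (inverse a) \<in> K \<and> inverse a \<noteq> 0"
    by (auto simp: power_inverse)
  then show ?thesis unfolding sq_units_def by blast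
qed

lemma sq_units_in: "s \<in> sq_units K \<Longrightarrow> s \<in> K"
  by (auto simp: sq_units_def power2_eq_square intro: K_mult)

lemma germ_comp:
  assumes k: "germ K F x k" and h: "germ K F' (k x) h"
    and F: "F \<le> nhds x" and lim: "filterlim k F' F"
  shows "germ K F x (h \<circ> k)"
proof -
  obtain A where A: "A \<in> sl K" "den A x \<noteq> 0" "k x = mob A x" "\<forall>\<^sub>F y in F. k y = mob A y"
    using k by (auto simp: germ_def)
  obtain B where B: "B \<in> sl K" "den B (k x) \<noteq> 0" "h (k x) = mob B (k x)"
      "\<forall>\<^sub>F y in F'. h y = mob B y"
    using h by (auto simp: germ_def)
  have "\<forall>\<^sub>F y in F. den A y \<noteq> 0"
    using A(2) F by (rule eventually_den_nonzero)
  moreover have "\<forall>\<^sub>F y in F. h (k y) = mob B (k y)"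
    using lim B(4) by (auto simp: filterlim_iff)
  ultimately have "\<forall>\<^sub>F y in F. (h \<circ> k) y = mob (B ** A) y"
    using A(4) by eventually_elim (auto simp: mob_mult)
  moreover have "den (B ** A) x \<noteq> 0" "(h \<circ> k) x = mob (B ** A) x"
    using A B by (simp_all add: mob_mult den_mult)
  ultimately show ?thesis
    using sl_mult [OF B(1) A(1)] unfolding germ_def by blast
qed

lemma germ_inv:
  assumes h: "germ K F x h" and inj: "inj h" and surj: "surj h"
    and F: "F \<le> nhds x" and lim: "filterlim (finv h) F F'"
  shows "germ K F' (h x) (finv h)"
proof -
  obtain A where A: "A \<in> sl K" "den A x \<noteq> 0" "h x = mob A x" "\<forall>\<^sub>F y in F. h y = mob A y"
    using h by (auto simp: germ_def)
  have "\<forall>\<^sub>F y in F. den A y \<noteq> 0"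
    using A(2) F by (rule eventually_den_nonzero)
  with A(4) have "\<forall>\<^sub>F y in F. mob (adj A) (h y) = y"
    by eventually_elim (auto simp: mob_adj_mob [OF A(1)])
  then have "\<forall>\<^sub>F y in F'. mob (adj A) (h (finv h y)) = finv h y"
    using lim by (auto simp: filterlim_iff)
  then have "\<forall>\<^sub>F y in F'. finv h y = mob (adj A) y"
    using surj by (simp add: surj_f_inv_f eq_commute)
  moreover have "finv h (h x) = mob (adj A) (h x)"
    using inv_f_f [OF inj, of x] mob_adj_mob [OF A(1,2)] A(3) by simp
  moreover have "den (adj A) (h x) \<noteq> 0"
    using den_adj_mob [OF A(1,2)] A(3) by auto
  ultimately show ?thesis using sl_adj [OF A(1)] by (auto simp: germ_def)
qed

lemma affine_at_comp:
  assumes "affine_at K F k" "affine_at K F' h" "filterlim k F' F"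
  shows "affine_at K F (h \<circ> k)"
proof -
  obtain s b where k: "s \<in> sq_units K" "b \<in> K" "\<forall>\<^sub>F y in F. k y = s * y + b"
    using assms(1) by (auto simp: affine_at_def)
  obtain t c where h: "t \<in> sq_units K" "c \<in> K" "\<forall>\<^sub>F y in F'. h y = t * y + c"
    using assms(2) by (auto simp: affine_at_def)
  have "\<forall>\<^sub>F y in F. h (k y) = t * k y + c"
    using assms(3) h(3) by (auto simp: filterlim_iff)
  with k(3) have "\<forall>\<^sub>F y in F. (h \<circ> k) y = (t * s) * y + (t * b + c)"
    by eventually_elim (simp add: algebra_simps)
  then show ?thesis
    using k h sq_units_mult [OF h(1) k(1)] K_add [OF K_mult [OF sq_units_in [OF h(1)] k(2)] h(2)]
    unfolding affine_at_def by blast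
qed

lemma affine_at_inv:
  assumes "affine_at K F h" "surj h" "filterlim (finv h) F F'"
  shows "affine_at K F' (finv h)"
proof -
  obtain s b where h: "s \<in> sq_units K" "b \<in> K" "\<forall>\<^sub>F y in F. h y = s * y + b"
    using assms(1) by (auto simp: affine_at_def)
  have s: "s > 0" using h(1) by (rule sq_unitsD)
  have "\<forall>\<^sub>F y in F'. h (finv h y) = s * finv h y + b"
    using assms(3) h(3) by (auto simp: filterlim_iff)
  then have "\<forall>\<^sub>F y in F'. finv h y = inverse s * y + (- (inverse s * b))"
    using s assms(2) by (auto simp: surj_f_inv_f field_simps elim: eventually_mono)
  moreover have "- (inverse s * b) \<in> K"
    using K_uminus [OF K_mult [OF sq_units_in [OF sq_units_inverse [OF h(1)]] h(2)]] .
  ultimately show ?thesis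
    using sq_units_inverse [OF h(1)] unfolding affine_at_def by blast
qed

end

locale breakpoint_set = subring_of_reals +
  fixes P :: "real set"
  assumes P_mob: "A \<in> sl K \<Longrightarrow> x \<in> P \<Longrightarrow> den A x \<noteq> 0 \<Longrightarrow> mob A x \<in> P"
begin

abbreviation G where "G \<equiv> PW K P"

lemma G_D:
  assumes "h \<in> G"
  shows "strict_mono h" "surj h" "germ K (at_left x) x h" "germ K (at_right x) x h"
    "x \<notin> P \<Longrightarrow> germ K (nhds x) x h" "affine_at K at_top h" "affine_at K at_bot h"
  using assms by (auto simp: PW_def)

lemma G_inj: "h \<in> G \<Longrightarrow> inj h"
  by (simp add: G_D(1) strict_mono_imp_inj_on)

lemma G_inv [simp]:
  assumes "h \<in> G" shows "finv h (h x) = x" "h (finv h x) = x"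
  using G_inj [OF assms] G_D(2) [OF assms] by (simp_all add: surj_f_inv_f)

lemma G_filterlim:
  assumes "h \<in> G"
  shows "filterlim h (nhds (h x)) (nhds x)"
    "filterlim h (at_right (h x)) (at_right x)" "filterlim h (at_left (h x)) (at_left x)"
    "filterlim h at_top at_top" "filterlim h at_bot at_bot"
  using filterlim_strict_mono_surj [OF G_D(1,2) [OF assms]] by auto

lemma G_image_P:
  assumes "h \<in> G" shows "h x \<in> P \<longleftrightarrow> x \<in> P"
proof -
  obtain A where A: "A \<in> sl K" "den A x \<noteq> 0" "h x = mob A x"
    using G_D(3) [OF assms, of x] by (auto simp: germ_def)
  have "den (adj A) (mob A x) \<noteq> 0"
    using den_adj_mob [OF A(1,2)] by auto
  then have "x \<in> P" if "mob A x \<in> P"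
    using P_mob [OF sl_adj [OF A(1)] that] mob_adj_mob [OF A(1,2)] by simp
  then show ?thesis
    using P_mob [OF A(1) _ A(2)] A(3) by auto
qed

lemma G_comp:
  assumes "h \<in> G" "k \<in> G" shows "h \<circ> k \<in> G"
proof -
  have "germ K (at_left x) x (h \<circ> k)" "germ K (at_right x) x (h \<circ> k)" for x
    using germ_comp [OF G_D(3) [OF assms(2)] G_D(3) [OF assms(1)] at_side_le_nhds(1) G_filterlim(3) [OF assms(2)]]
      germ_comp [OF G_D(4) [OF assms(2)] G_D(4) [OF assms(1)] at_side_le_nhds(2) G_filterlim(2) [OF assms(2)]]
    by simp_all
  moreover have "germ K (nhds x) x (h \<circ> k)" if "x \<notin> P" for x
    using germ_comp [OF G_D(5) [OF assms(2) that] G_D(5) [OF assms(1)] order_refl G_filterlim(1) [OF assms(2)]]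
      that G_image_P [OF assms(2)] by simp
  moreover have "affine_at K at_top (h \<circ> k)" "affine_at K at_bot (h \<circ> k)"
    using affine_at_comp [OF G_D(6) [OF assms(2)] G_D(6) [OF assms(1)] G_filterlim(4) [OF assms(2)]]
      affine_at_comp [OF G_D(7) [OF assms(2)] G_D(7) [OF assms(1)] G_filterlim(5) [OF assms(2)]]
    by simp_all
  moreover have "strict_mono (h \<circ> k)"
    using G_D(1) [OF assms(1)] G_D(1) [OF assms(2)] by (simp add: strict_mono_def)
  moreover have "surj (h \<circ> k)"
    using G_D(2) [OF assms(1)] G_D(2) [OF assms(2)] by (intro comp_surj)
  ultimately show ?thesis by (simp add: PW_def)
qed

lemma G_inv_mem:
  assumes "h \<in> G" shows "finv h \<in> G"
proof -
  note i = strict_mono_inv [OF G_D(1,2) [OF assms]]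
  note lim = filterlim_strict_mono_surj [OF i]
  have "germ K (at_left x) x (finv h)" "germ K (at_right x) x (finv h)" for x
    using germ_inv [OF G_D(3) [OF assms] G_inj [OF assms] G_D(2) [OF assms] at_side_le_nhds(1) lim(3), of x]
      germ_inv [OF G_D(4) [OF assms] G_inj [OF assms] G_D(2) [OF assms] at_side_le_nhds(2) lim(2), of x] assms
    by simp_all
  moreover have "germ K (nhds x) x (finv h)" if "x \<notin> P" for x
    using germ_inv [OF G_D(5) [OF assms] G_inj [OF assms] G_D(2) [OF assms] order_refl lim(1), of x]
      assms that G_image_P [OF assms, of "finv h x"] by simp
  moreover have "affine_at K at_top (finv h)" "affine_at K at_bot (finv h)"
    using affine_at_inv [OF G_D(6) [OF assms] G_D(2) [OF assms] lim(4)]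
      affine_at_inv [OF G_D(7) [OF assms] G_D(2) [OF assms] lim(5)]
    by simp_all
  ultimately show ?thesis using i by (simp add: PW_def)
qed

end

section \<open>Bridges between elements\<close>

lemma germ_cong:
  assumes "germ K F x h" "h x = g x" "\<forall>\<^sub>F y in F. h y = g y"
  shows "germ K F x g"
proof -
  obtain A where A: "A \<in> sl K" "den A x \<noteq> 0" "h x = mob A x" "\<forall>\<^sub>F y in F. h y = mob A y"
    using assms(1) by (auto simp: germ_def)
  have "\<forall>\<^sub>F y in F. g y = mob A y"
    using A(4) assms(3) by eventually_elim simp
  with A assms(2) show ?thesis unfolding germ_def by auto
qed

lemma affine_at_cong:
  assumes "affine_at K F h" "\<forall>\<^sub>F y in F. h y = g y"
  shows "affine_at K F g"
proof -
  obtain s b where A: "s \<in> sq_units K" "b \<in> K" "\<forall>\<^sub>F y in F. h y = s * y + b"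
    using assms(1) by (auto simp: affine_at_def)
  have "\<forall>\<^sub>F y in F. g y = s * y + b"
    using A(3) assms(2) by eventually_elim simp
  with A show ?thesis unfolding affine_at_def by auto
qed

lemma germ_mono: "germ K F x h \<Longrightarrow> F' \<le> F \<Longrightarrow> germ K F' x h"
  unfolding germ_def using filter_leD by blast

lemma germ_mob: "C \<in> sl K \<Longrightarrow> den C x \<noteq> 0 \<Longrightarrow> germ K F x (mob C)"
  by (auto simp: germ_def)

context breakpoint_set
begin

lemma G_less: "h \<in> G \<Longrightarrow> h x < h y \<longleftrightarrow> x < y"
  using G_D(1) by (simp add: strict_mono_less)

lemma G_le: "h \<in> G \<Longrightarrow> h x \<le> h y \<longleftrightarrow> x \<le> y"
  using G_D(1) by (simp add: strict_mono_less_eq)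

text \<open>The element follows \<open>f1\<close> up to \<open>u\<close>, then \<open>mob C\<close> up to \<open>v\<close>, then \<open>f2\<close>. The conditions on \<open>C\<close> keep
  its pole, if any, to the left of \<open>u\<close>, so that \<open>mob C\<close> is increasing and continuous from \<open>u\<close> onwards.\<close>

lemma paste:
  assumes f: "f1 \<in> G" "f2 \<in> G" and C: "C \<in> sl K" "C$2$1 \<ge> 0" "den C u > 0"
    and uv: "u < v" "u \<in> P" "v \<in> P" "mob C u = f1 u" "mob C v = f2 v"
  shows "(\<lambda>t. if t \<le> u then f1 t else if t \<le> v then mob C t else f2 t) \<in> G" (is "?g \<in> G")
proof -
  have den: "den C t > 0" if "u \<le> t" for t
  proof -
    have "C$2$1 * u \<le> C$2$1 * t" using C(2) that by (simp add: mult_left_mono)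
    then show ?thesis using C(3) by (simp add: den_def)
  qed
  have Cless: "mob C s < mob C t" if "u \<le> s" "s < t" for s t
    using mob_less [OF C(1) that(2)] den [of s] den [of t] that by simp
  have mono: "?g s < ?g t" if "s < t" for s t
  proof -
    consider "t \<le> u" | "s \<le> u" "u < t" "t \<le> v" | "s \<le> u" "v < t" | "u < s" "t \<le> v"
      | "u < s" "s \<le> v" "v < t" | "v < s"
      using \<open>s < t\<close> by linarith
    then show ?thesis
    proof cases
      case 2
      then have "f1 s \<le> f1 u" "mob C u < mob C t" using Cless G_le [OF f(1)] by auto
      then show ?thesis using 2 uv by simp
    next
      case 3
      then have "f1 s \<le> f1 u" "mob C u < mob C v" "f2 v < f2 t"
        using Cless [of u v] G_le [OF f(1)] G_less [OF f(2)] uv by auto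
      then show ?thesis using 3 uv by simp
    next
      case 5
      then have "mob C s \<le> mob C v" "f2 v < f2 t"
        using Cless [of s v] G_less [OF f(2)] by (cases "s = v"; auto)+
      then show ?thesis using 5 uv by simp
    qed (use \<open>s < t\<close> uv Cless G_less [OF f(1)] G_less [OF f(2)] in auto)
  qed
  have surj: "\<exists>t. ?g t = y" for y
  proof -
    consider "y \<le> f1 u" | "f1 u < y" "y \<le> f2 v" | "f2 v < y" by linarith
    then show ?thesis
    proof cases
      case 1
      obtain t where t: "f1 t = y" using G_D(2) [OF f(1)] by (metis surjD)
      then have "t \<le> u" using 1 G_le [OF f(1)] by blast
      then show ?thesis using t by (intro exI [of _ t]) auto
    next
      case 2
      have "continuous_on {u..v} (mob C)"
        using den by (intro continuous_at_imp_continuous_on ballI isCont_mob) force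
      then obtain t where "u \<le> t" "t \<le> v" "mob C t = y"
        using IVT' [of "mob C" u y v] 2 uv by auto
      then show ?thesis using 2 uv by (intro exI [of _ t]) auto
    next
      case 3
      obtain t where t: "f2 t = y" using G_D(2) [OF f(2)] by (metis surjD)
      then have "v < t" using 3 G_less [OF f(2)] by blast
      then show ?thesis using t uv by (intro exI [of _ t]) auto
    qed
  qed
  have germs: "germ K (at_left x) x ?g \<and> germ K (at_right x) x ?g \<and> (x \<notin> P \<longrightarrow> germ K (nhds x) x ?g)"
    for x
  proof -
    have 1: ?thesis if "germ K (nhds x) x h" "?g x = h x" "\<forall>\<^sub>F y in nhds x. h y = ?g y" for h
      using germ_cong [OF that(1) that(2) [symmetric] that(3)] germ_mono at_side_le_nhds by blast
    have 2: ?thesis if "h \<in> G" "?g x = h x" and e: "\<forall>\<^sub>F y in nhds x. h y = ?g y" for h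
      using germ_cong [OF G_D(3) [OF that(1)] that(2) [symmetric] filter_leD [OF at_side_le_nhds(1) e]]
        germ_cong [OF G_D(4) [OF that(1)] that(2) [symmetric] filter_leD [OF at_side_le_nhds(2) e]]
        germ_cong [OF G_D(5) [OF that(1)] that(2) [symmetric] e]
      by blast
    consider "x < u" | "x = u" | "u < x" "x < v" | "x = v" | "v < x" by linarith
    then show ?thesis
    proof cases
      case 1
      have "\<forall>\<^sub>F y in nhds x. y < u"
        using 1 by (intro order_tendstoD(2) [OF filterlim_ident])
      then have "\<forall>\<^sub>F y in nhds x. f1 y = ?g y" by eventually_elim auto
      then show ?thesis using 2 [OF f(1)] 1 by simp
    next
      case 2
      have l: "\<forall>\<^sub>F y in at_left x. y < u" and r: "\<forall>\<^sub>F y in at_right x. u < y"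
        using 2 by (auto simp: eventually_at_filter)
      have r': "\<forall>\<^sub>F y in at_right x. y < v"
        using 2 uv(1) by (intro order_tendstoD(2) [OF tendsto_ident_at]) simp
      from l have el: "\<forall>\<^sub>F y in at_left x. f1 y = ?g y" by eventually_elim simp
      from r r' have er: "\<forall>\<^sub>F y in at_right x. mob C y = ?g y" by eventually_elim simp
      note e = el er
      show ?thesis
        using germ_cong [OF G_D(3) [OF f(1)] _ e(1)] germ_cong [OF germ_mob [OF C(1)] _ e(2)]
          2 uv C(3) by auto
    next
      case 3
      have "\<forall>\<^sub>F y in nhds x. u < y" "\<forall>\<^sub>F y in nhds x. y < v"
        using 3 by (auto intro: order_tendstoD [OF filterlim_ident])
      then have "\<forall>\<^sub>F y in nhds x. mob C y = ?g y" by eventually_elim auto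
      then show ?thesis using 1 [OF germ_mob [OF C(1)]] 3 den [of x] by auto
    next
      case 4
      have r: "\<forall>\<^sub>F y in at_right x. v < y" and l: "\<forall>\<^sub>F y in at_left x. y < v"
        using 4 by (auto simp: eventually_at_filter)
      have l': "\<forall>\<^sub>F y in at_left x. u < y"
        using 4 uv(1) by (intro order_tendstoD(1) [OF tendsto_ident_at]) simp
      from l l' have el: "\<forall>\<^sub>F y in at_left x. mob C y = ?g y" by eventually_elim simp
      from r have er: "\<forall>\<^sub>F y in at_right x. f2 y = ?g y"
        by eventually_elim (use uv(1) in simp)
      note e = el er
      show ?thesis
        using germ_cong [OF G_D(4) [OF f(2)] _ e(2)] germ_cong [OF germ_mob [OF C(1)] _ e(1)]
          4 uv den [of x] by auto
    next
      case 5
      have "\<forall>\<^sub>F y in nhds x. v < y"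
        using 5 by (intro order_tendstoD(1) [OF filterlim_ident])
      then have "\<forall>\<^sub>F y in nhds x. f2 y = ?g y" by eventually_elim (use uv in auto)
      then show ?thesis using 2 [OF f(2)] 5 uv(1) by simp
    qed
  qed
  have "\<forall>\<^sub>F y in at_bot. f1 y = ?g y"
    by (rule eventually_mono [OF eventually_le_at_bot [of u]]) auto
  then have "affine_at K at_bot ?g"
    by (rule affine_at_cong [OF G_D(7) [OF f(1)]])
  moreover have "\<forall>\<^sub>F y in at_top. f2 y = ?g y"
    by (rule eventually_mono [OF eventually_gt_at_top [of v]]) (use uv in auto)
  then have "affine_at K at_top ?g"
    by (rule affine_at_cong [OF G_D(6) [OF f(2)]])
  moreover have "strict_mono ?g" using mono by (intro strict_monoI)
  moreover have "surj ?g"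
    unfolding surj_def
  proof
    fix y obtain t where "?g t = y" using surj [of y] by blast
    then show "\<exists>x. y = ?g x" by (intro exI [of _ t]) (rule sym)
  qed
  ultimately show ?thesis
    using germs unfolding PW_def by blast
qed

lemma affine_G:
  assumes "s \<in> sq_units K" "b \<in> K"
  shows "(\<lambda>x. s * x + b) \<in> G"
proof -
  have s: "s > 0" using assms(1) by (rule sq_unitsD)
  obtain a where a: "s = a\<^sup>2" "a \<in> K" "inverse a \<in> K" "a \<noteq> 0"
    using assms(1) by (auto simp: sq_units_def)
  define A where "A = matrix_2x2 a (b * inverse a) 0 (inverse a)"
  have A: "A \<in> sl K"
    using a assms(2) by (simp add: A_def sl_iff K_mult)
  have den: "den A x \<noteq> 0" for x using a by (simp add: A_def den_def)
  have mob: "mob A = (\<lambda>x. s * x + b)"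
  proof
    fix x
    have "mob A x = (a * x + b * inverse a) / inverse a"
      by (simp add: A_def mob_def den_def)
    also have "\<dots> = a * a * x + b * (inverse a * a)"
      by (simp add: divide_inverse algebra_simps)
    also have "\<dots> = s * x + b"
      using a(4) by (simp add: a(1) power2_eq_square)
    finally show "mob A x = s * x + b" .
  qed
  have "strict_mono (\<lambda>x. s * x + b)" using s by (auto intro: strict_monoI)
  moreover have "surj (\<lambda>x. s * x + b)"
    by (rule surjI [of _ "\<lambda>y. (y - b) / s"]) (use s in simp)
  moreover have "germ K F x (\<lambda>x. s * x + b)" for F x
    using germ_mob [OF A den] by (simp add: mob)
  moreover have "affine_at K F (\<lambda>x. s * x + b)" for F
    using assms unfolding affine_at_def by (intro bexI [of _ s] bexI [of _ b]) auto
  ultimately show ?thesis by (simp add: PW_def)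
qed

lemma translation_G: "b \<in> K \<Longrightarrow> (\<lambda>x. x + b) \<in> G"
  using affine_G [OF sq_units_1] by simp

lemma id_G: "id \<in> G"
  using translation_G [of 0] by (simp add: id_def)

end

text \<open>The two prescribed maps are joined by a single Moebius map, which starts on the graph of the first
  one just to the right of \<open>x\<close> and ends on the graph of the second one just to the left of \<open>y\<close>. Only
  approximate positions can be prescribed, because the end points must be admissible breakpoints.
  The pole is required to lie to the left of \<open>u\<close>; besides making the map increasing on \<open>[u, v]\<close> this
  makes it concave there, which is what \<open>push_element\<close> needs.\<close>

locale bridged = breakpoint_set +
  assumes bridge:
    "\<lbrakk>A \<in> sl K; B \<in> sl K; x < y; den A x \<noteq> 0; den B y \<noteq> 0; mob A x < mob B y; 0 < \<delta>\<rbrakk> \<Longrightarrow>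
      \<exists>C\<in>sl K. \<exists>u\<in>P. \<exists>v\<in>P. x < u \<and> u < x + \<delta> \<and> y - \<delta> < v \<and> v < y \<and> u < v \<and>
        C$2$1 > 0 \<and> den C u > 0 \<and> mob C u = mob A u \<and> mob C v = mob B v"
begin

text \<open>The bridge is taken so close to \<open>x\<close> and \<open>y\<close> that each of the two elements is still given by one
  Moebius map there.\<close>

lemma connect_bridge:
  assumes f: "f1 \<in> G" "f2 \<in> G" and xy: "x < y" "f1 x < f2 y"
  obtains C u v where "C \<in> sl K" "u \<in> P" "v \<in> P" "x < u" "u < v" "v < y"
    "C$2$1 > 0" "den C u > 0" "mob C u = f1 u" "mob C v = f2 v"
proof -
  obtain A where A: "A \<in> sl K" "den A x \<noteq> 0" "f1 x = mob A x" "\<forall>\<^sub>F y in at_right x. f1 y = mob A y"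
    using G_D(4) [OF f(1), of x] by (auto simp: germ_def)
  obtain B where B: "B \<in> sl K" "den B y \<noteq> 0" "f2 y = mob B y" "\<forall>\<^sub>F x in at_left y. f2 x = mob B x"
    using G_D(3) [OF f(2), of y] by (auto simp: germ_def)
  obtain b1 where b1: "b1 > x" "\<And>t. x < t \<Longrightarrow> t < b1 \<Longrightarrow> f1 t = mob A t"
    using A(4) by (auto simp: eventually_at_right_field)
  obtain b2 where b2: "b2 < y" "\<And>t. b2 < t \<Longrightarrow> t < y \<Longrightarrow> f2 t = mob B t"
    using B(4) by (auto simp: eventually_at_left_field)
  define \<delta> where "\<delta> = min (b1 - x) (y - b2)"
  have \<delta>: "\<delta> > 0" "x + \<delta> \<le> b1" "b2 \<le> y - \<delta>" using b1 b2 by (auto simp: \<delta>_def)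
  obtain C u v where "C \<in> sl K" "u \<in> P" "v \<in> P" "x < u" "u < x + \<delta>" "y - \<delta> < v" "v < y" "u < v"
    "C$2$1 > 0" "den C u > 0" "mob C u = mob A u" "mob C v = mob B v"
    using bridge [OF A(1) B(1) xy(1) A(2) B(2) _ \<delta>(1)] xy(2) A(3) B(3) by auto
  then show ?thesis using b1(2) [of u] b2(2) [of v] \<delta> that by auto
qed

lemma connect:
  assumes f: "f1 \<in> G" "f2 \<in> G" and xy: "x < y" "f1 x < f2 y"
  shows "\<exists>g\<in>G. \<exists>x' y'. x < x' \<and> x' < y' \<and> y' < y \<and> (\<forall>t\<le>x'. g t = f1 t) \<and> (\<forall>t\<ge>y'. g t = f2 t)"
proof -
  obtain C u v where C: "C \<in> sl K" "u \<in> P" "v \<in> P" "x < u" "u < v" "v < y"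
    "C$2$1 > 0" "den C u > 0" "mob C u = f1 u" "mob C v = f2 v"
    using connect_bridge [OF assms] by blast
  define g where "g = (\<lambda>t. if t \<le> u then f1 t else if t \<le> v then mob C t else f2 t)"
  have "g \<in> G"
    unfolding g_def using C f by (intro paste) auto
  then show ?thesis
    by (intro bexI [of _ g] exI [of _ u] exI [of _ v]) (use C in \<open>auto simp: g_def\<close>)
qed

text \<open>Follow the translation by one, then a bridge down to the diagonal, then the identity. By concavity
  the bridge cannot meet the diagonal before its end point.\<close>

lemma push_element:
  obtains g w where "g \<in> G" "\<And>t. t < w \<Longrightarrow> g t > t" "\<And>t. t \<ge> w \<Longrightarrow> g t = t"
proof -
  note T = translation_G [OF K_1]
  obtain C u v where C: "C \<in> sl K" "u \<in> P" "v \<in> P" "0 < u" "u < v" "v < 2"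
    "C$2$1 > 0" "den C u > 0" "mob C u = u + 1" "mob C v = v"
    using connect_bridge [OF T id_G, of 0 2] by auto
  define g where "g = (\<lambda>t. if t \<le> u then t + 1 else if t \<le> v then mob C t else id t)"
  have "g \<in> G"
    unfolding g_def by (rule paste [OF T id_G C(1)]) (use C in simp_all)
  moreover have "g t = t" if "t \<ge> v" for t using that C by (auto simp: g_def)
  moreover have "g t > t" if "t < v" for t
  proof (cases "t \<le> u")
    case False
    have den: "den C t > 0" if "u \<le> t" for t
    proof -
      have "C$2$1 * u \<le> C$2$1 * t" using C(7) that by (simp add: mult_left_mono)
      then show ?thesis using C(8) by (simp add: den_def)
    qed
    define q where "q t = C$1$1 * t + C$1$2 - t * den C t" for t
    have q: "mob C t - t = q t / den C t" if "u \<le> t" for t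
      using den [OF that] by (simp add: q_def mob_def field_simps)
    have "q u > 0" "q v = 0"
      using q [of u] q [of v] den [of u] den [of v] C by (auto simp: zero_less_divide_iff)
    \<comment> \<open>\<open>q\<close> is a concave quadratic.\<close>
    have "(v - u) * q t = (v - t) * q u + (t - u) * q v + C$2$1 * (v - u) * (v - t) * (t - u)"
      by (simp add: q_def den_def algebra_simps)
    moreover have "\<dots> > 0"
      using \<open>q u > 0\<close> \<open>q v = 0\<close> C that False by (simp add: add_pos_pos)
    ultimately have "(v - u) * q t > 0" by simp
    then have "q t > 0" using C(5) by (simp add: zero_less_mult_iff)
    then have "mob C t - t > 0" using q [of t] den [of t] False by simp
    then show ?thesis using False that by (simp add: g_def)
  qed (simp add: g_def)
  ultimately show ?thesis using that by blast
qed

text \<open>Two integer translations may be far too coarse to hit a small interval, but they can be chosen so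
  that one sends a point left of \<open>w\<close>, and the other a point right of \<open>w\<close>, into it; an element
  connecting the two translations then sends \<open>w\<close> there as well.\<close>

lemma move_into:
  assumes "u < v"
  obtains g where "g \<in> G" "u < g w" "g w < v"
proof -
  define a where "a = u + (v - u) / 3"
  define b where "b = u + 2 * (v - u) / 3"
  have ab: "u < a" "a < b" "b < v" using assms by (simp_all add: a_def b_def field_simps)
  obtain m where m: "a - of_int m < w" 
    using ex_less_of_int [of "a - w"] by (auto simp: algebra_simps)
  obtain n where n: "w < b - of_int n" 
    using ex_of_int_less [of "b - w"] by (auto simp: algebra_simps)
  have "a - of_int m < b - of_int n" "a - of_int m + of_int m < b - of_int n + of_int n"
    using m n ab by simp_all
  from connect [OF translation_G [OF K_of_int] translation_G [OF K_of_int] this]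
  obtain g x' y' where g: "g \<in> G" "a - of_int m < x'" "x' < y'" "y' < b - of_int n"
    "\<And>t. t \<le> x' \<Longrightarrow> g t = t + of_int m" "\<And>t. t \<ge> y' \<Longrightarrow> g t = t + of_int n"
    by blast
  have "g (a - of_int m) < g w" "g w < g (b - of_int n)"
    using m n by (simp_all add: G_less [OF g(1)])
  then have "a < g w" "g w < b" using g by simp_all
  then show ?thesis using that [OF g(1)] ab by linarith
qed

end

section \<open>Subgroups meeting every conjugacy class\<close>

text \<open>A bounded increasing orbit would converge to a fixed point.\<close>

lemma exceeds_by_iteration:
  fixes p :: "real \<Rightarrow> real"
  assumes cont: "\<And>x. isCont p x" and up: "\<And>t. t < w \<Longrightarrow> t < p t" and "u < w"
  shows "\<exists>n. u < (p ^^ n) a"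
proof (rule ccontr)
  assume "\<not> ?thesis"
  then have le: "(p ^^ n) a \<le> u" for n by (simp add: not_less)
  define xs where "xs n = (p ^^ n) a" for n
  have "xs n \<le> xs (Suc n)" for n
    using up [of "xs n"] le [of n] \<open>u < w\<close> by (simp add: xs_def)
  then have "incseq xs" by (rule incseq_SucI)
  moreover have "\<forall>n. xs n \<le> u" using le by (simp add: xs_def)
  ultimately obtain L where L: "xs \<longlonglongrightarrow> L" "\<forall>n. xs n \<le> L"
    using incseq_convergent [of xs u] by auto
  have "L \<le> u" using L(1) le by (intro LIMSEQ_le_const2 [OF L(1)]) (auto simp: xs_def)
  have "(\<lambda>n. p (xs n)) \<longlonglongrightarrow> p L"
    using cont L(1) by (rule isCont_tendsto_compose)
  moreover have "(\<lambda>n. p (xs n)) = (\<lambda>n. xs (Suc n))" by (simp add: xs_def)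
  ultimately have "p L = L"
    using LIMSEQ_Suc [OF L(1)] LIMSEQ_unique by metis
  then show False using up [of L] \<open>L \<le> u\<close> \<open>u < w\<close> by simp
qed

lemma finv_eqI:
  assumes "\<And>x. g (f x) = x" "\<And>y. f (g y) = y"
  shows "finv f = g"
  by (rule inv_equality) (use assms in auto)

context breakpoint_set
begin

lemma G_conj_funpow: "\<gamma> \<in> G \<Longrightarrow> ((\<gamma> \<circ> g \<circ> finv \<gamma>) ^^ n) (\<gamma> x) = \<gamma> ((g ^^ n) x)"
  by (induction n) simp_all

lemma G_isCont: "h \<in> G \<Longrightarrow> isCont h x"
  using continuous_strict_mono_surj G_D(1,2) by blast

definition is_end :: "real filter \<Rightarrow> bool" where
  "is_end F \<longleftrightarrow> F = at_top \<or> F = at_bot"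

lemma G_end: "is_end F \<Longrightarrow> h \<in> G \<Longrightarrow> filterlim h F F" "is_end F \<Longrightarrow> h \<in> G \<Longrightarrow> affine_at K F h"
  using G_filterlim(4,5) G_D(6,7) by (auto simp: is_end_def)

text \<open>Conjugating by an element with germ \<open>\<sigma> y + \<tau>\<close> keeps the slope and changes the translation part
  in a controlled way.\<close>

lemma conjugate_end_germ:
  assumes "is_end F" "\<gamma> \<in> G" and g: "g \<in> G" "\<forall>\<^sub>F y in F. g y = s * y + b"
  shows "\<exists>\<sigma>\<in>sq_units K. \<exists>\<tau>\<in>K. \<forall>\<^sub>F y in F. (\<gamma> \<circ> g \<circ> finv \<gamma>) y = s * y + (\<sigma> * b + \<tau> * (1 - s))"
proof -
  obtain \<sigma> \<tau> where st: "\<sigma> \<in> sq_units K" "\<tau> \<in> K" "\<forall>\<^sub>F y in F. \<gamma> y = \<sigma> * y + \<tau>"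
    using G_end(2) [OF assms(1,2)] by (auto simp: affine_at_def)
  note lim = G_end(1) [OF assms(1) G_inv_mem [OF assms(2)]]
  have "\<forall>\<^sub>F z in F. \<gamma> (g z) = \<sigma> * g z + \<tau>"
    using G_end(1) [OF assms(1) g(1)] st(3) by (auto simp: filterlim_iff)
  with st(3) g(2) have "\<forall>\<^sub>F z in F. \<gamma> (g z) = s * \<gamma> z + (\<sigma> * b + \<tau> * (1 - s))"
    by eventually_elim (simp add: algebra_simps)
  then have "\<forall>\<^sub>F y in F. \<gamma> (g (finv \<gamma> y)) = s * \<gamma> (finv \<gamma> y) + (\<sigma> * b + \<tau> * (1 - s))"
    using lim by (auto simp: filterlim_iff)
  then show ?thesis using st(1,2) assms(2) by auto
qed

text \<open>This is the invariable generation of the group of affine germs. A translation by some multiple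
  \<open>\<sigma> b\<close> is present for each \<open>b\<close>, and conjugating it by a germ of slope \<open>\<sigma>\<inverse>\<close> gives the translation
  by \<open>b\<close>. With all translations at hand, one germ of each slope suffices.\<close>

lemma all_affine_germs:
  assumes F: "is_end F" and S: "S \<subseteq> G" "\<And>f g. f \<in> S \<Longrightarrow> g \<in> S \<Longrightarrow> f \<circ> g \<in> S" "\<And>f. f \<in> S \<Longrightarrow> finv f \<in> S"
    and conj: "\<And>s b. s \<in> sq_units K \<Longrightarrow> b \<in> K \<Longrightarrow>
      \<exists>g\<in>S. \<exists>\<sigma>\<in>sq_units K. \<exists>\<tau>\<in>K. \<forall>\<^sub>F y in F. g y = s * y + (\<sigma> * b + \<tau> * (1 - s))"
    and sb: "s \<in> sq_units K" "b \<in> K"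
  shows "\<exists>g\<in>S. \<forall>\<^sub>F y in F. g y = s * y + b"
proof -
  have trans: "\<exists>g\<in>S. \<forall>\<^sub>F y in F. g y = y + b" if b: "b \<in> K" for b
  proof -
    obtain g1 \<sigma> where g1: "g1 \<in> S" "\<sigma> \<in> sq_units K" "\<forall>\<^sub>F y in F. g1 y = y + \<sigma> * b"
      using conj [OF sq_units_1 b] by auto
    have \<sigma>: "\<sigma> > 0" using g1(2) by (rule sq_unitsD)
    obtain g2 \<tau> where g2: "g2 \<in> S" "\<forall>\<^sub>F y in F. g2 y = inverse \<sigma> * y + \<tau>"
      using conj [OF sq_units_inverse [OF g1(2)] K_0] by auto
    have G: "g1 \<in> G" "g2 \<in> G" using g1 g2 S by auto
    have "\<forall>\<^sub>F z in F. g2 (g1 z) = inverse \<sigma> * g1 z + \<tau>"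
      using G_end(1) [OF F G(1)] g2(2) by (auto simp: filterlim_iff)
    with g1(3) g2(2) have "\<forall>\<^sub>F z in F. g2 (g1 z) = g2 z + b"
      by eventually_elim (use \<sigma> in \<open>simp add: distrib_left\<close>)
    then have "\<forall>\<^sub>F y in F. g2 (g1 (finv g2 y)) = g2 (finv g2 y) + b"
      using G_end(1) [OF F G_inv_mem [OF G(2)]] by (auto simp: filterlim_iff)
    then have "\<forall>\<^sub>F y in F. (g2 \<circ> g1 \<circ> finv g2) y = y + b"
      using G by simp
    then show ?thesis using S g1(1) g2(1) by blast
  qed
  obtain g \<sigma> \<tau> where g: "g \<in> S" "\<sigma> \<in> sq_units K" "\<tau> \<in> K" "\<forall>\<^sub>F y in F. g y = s * y + (\<sigma> * b + \<tau> * (1 - s))"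
    using conj [OF sb] by blast
  define c where "c = b - (\<sigma> * b + \<tau> * (1 - s))"
  have "c \<in> K"
    unfolding c_def using g(3) sb(2) sq_units_in [OF g(2)] sq_units_in [OF sb(1)]
    by (intro K_diff K_add K_mult K_1)
  then obtain h where h: "h \<in> S" "\<forall>\<^sub>F y in F. h y = y + c"
    using trans by blast
  have "\<forall>\<^sub>F y in F. h (g y) = g y + c"
    using G_end(1) [OF F] h(2) g(1) S(1) by (auto simp: filterlim_iff)
  with g(4) have "\<forall>\<^sub>F y in F. (h \<circ> g) y = s * y + b"
    by eventually_elim (simp add: c_def)
  then show ?thesis using S(2) [OF h(1) g(1)] by blast
qed

end

text \<open>The assumption on the translation is no loss of generality, because \<open>H\<close> may be replaced by any of
  its conjugates.\<close>

locale meets_conjugates = bridged +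
  fixes H :: "(real \<Rightarrow> real) set"
  assumes H_G: "H \<subseteq> G" and H_id: "id \<in> H"
    and H_comp: "f \<in> H \<Longrightarrow> g \<in> H \<Longrightarrow> f \<circ> g \<in> H"
    and H_inv: "f \<in> H \<Longrightarrow> finv f \<in> H"
    and H_meets: "g \<in> G \<Longrightarrow> \<exists>\<gamma>\<in>G. \<gamma> \<circ> g \<circ> finv \<gamma> \<in> H"
    and H_translation: "(\<lambda>x. x + 1) \<in> H"
begin

lemma H_in_G: "h \<in> H \<Longrightarrow> h \<in> G" using H_G by blast

lemma H_funpow: "h \<in> H \<Longrightarrow> h ^^ n \<in> H"
  by (induction n) (auto simp: H_id H_comp)

lemma H_nat_translation: "(\<lambda>x. x + of_nat n) \<in> H" "(\<lambda>x. x - of_nat n) \<in> H"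
proof -
  have "((\<lambda>x::real. x + 1) ^^ n) = (\<lambda>x. x + of_nat n)"
    by (induction n) (auto simp: fun_eq_iff)
  then show 1: "(\<lambda>x. x + of_nat n) \<in> H"
    using H_funpow [OF H_translation, of n] by simp
  have "finv (\<lambda>x. x + of_nat n) = (\<lambda>x. x - of_nat n)"
    by (rule finv_eqI) auto
  then show "(\<lambda>x. x - of_nat n) \<in> H"
    using H_inv [OF 1] by simp
qed

lemma H_germs_bot:
  assumes "s \<in> sq_units K" "b \<in> K"
  shows "\<exists>h\<in>H. \<forall>\<^sub>F y in at_bot. h y = s * y + b"
proof (rule all_affine_germs [OF _ H_G H_comp H_inv _ assms])
  show e: "is_end at_bot" by (simp add: is_end_def)
  fix s b assume sb: "s \<in> sq_units K" "b \<in> K"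
  note A = affine_G [OF sb]
  obtain \<gamma> where \<gamma>: "\<gamma> \<in> G" "\<gamma> \<circ> (\<lambda>x. s * x + b) \<circ> finv \<gamma> \<in> H" using H_meets [OF A] by blast
  then show "\<exists>g\<in>H. \<exists>\<sigma>\<in>sq_units K. \<exists>\<tau>\<in>K. \<forall>\<^sub>F y in at_bot. g y = s * y + (\<sigma> * b + \<tau> * (1 - s))"
    using conjugate_end_germ [OF e \<gamma>(1) A always_eventually, of s b] by (intro bexI [OF _ \<gamma>(2)]) simp
qed

text \<open>The germ at the other end can be kept trivial, because conjugation preserves triviality. This
  independence of the two ends is needed for reducing to compact support.\<close>

lemma H_germs_top:
  assumes "s \<in> sq_units K" "b \<in> K"
  shows "\<exists>h\<in>H. (\<forall>\<^sub>F y in at_bot. h y = y) \<and> (\<forall>\<^sub>F y in at_top. h y = s * y + b)"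
proof -
  define S where "S = {h \<in> H. \<forall>\<^sub>F y in at_bot. h y = y}"
  have e: "is_end at_top" "is_end at_bot" by (simp_all add: is_end_def)
  have "\<exists>h\<in>S. \<forall>\<^sub>F y in at_top. h y = s * y + b"
  proof (rule all_affine_germs [OF e(1) _ _ _ _ assms])
    show "S \<subseteq> G" using H_G by (auto simp: S_def)
    show "f \<circ> g \<in> S" if fg: "f \<in> S" "g \<in> S" for f g
    proof -
      have f: "\<forall>\<^sub>F y in at_bot. f y = y" and g: "\<forall>\<^sub>F y in at_bot. g y = y"
        and H: "f \<in> H" "g \<in> H"
        using fg by (auto simp: S_def)
      from f g have "\<forall>\<^sub>F y in at_bot. (f \<circ> g) y = y" by eventually_elim simp
      then show ?thesis using H H_comp by (simp add: S_def)
    qed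
    show "finv f \<in> S" if f: "f \<in> S" for f
    proof -
      have ev: "\<forall>\<^sub>F y in at_bot. f y = y" and H: "f \<in> H"
        using f by (auto simp: S_def)
      have "\<forall>\<^sub>F y in at_bot. finv f y = y"
        using ev by eventually_elim (metis G_inv(1) H H_in_G)
      then show ?thesis using H H_inv by (simp add: S_def)
    qed
    fix s b assume sb: "s \<in> sq_units K" "b \<in> K"
    have s: "s > 0" using sb(1) by (rule sq_unitsD)
    define y where "y = (\<bar>b\<bar> + 1) / s"
    have y: "0 < y" "id 0 < s * y + b" using s by (auto simp: y_def)
    obtain g x' y' where g: "g \<in> G" "0 < x'" "x' < y'" "y' < y"
        "\<And>t. t \<le> x' \<Longrightarrow> g t = id t" "\<And>t. t \<ge> y' \<Longrightarrow> g t = s * t + b"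
      using connect [OF id_G affine_G [OF sb] y] by blast
    have bot: "\<forall>\<^sub>F t in at_bot. g t = 1 * t + 0"
      using g(5) by (auto simp: eventually_at_bot_linorder)
    have top: "\<forall>\<^sub>F t in at_top. g t = s * t + b"
      using g(6) by (auto simp: eventually_at_top_linorder)
    obtain \<gamma> where \<gamma>: "\<gamma> \<in> G" "\<gamma> \<circ> g \<circ> finv \<gamma> \<in> H" using H_meets [OF g(1)] by blast
    have "\<forall>\<^sub>F y in at_bot. (\<gamma> \<circ> g \<circ> finv \<gamma>) y = y"
      using conjugate_end_germ [OF e(2) \<gamma>(1) g(1) bot] by auto
    then have "\<gamma> \<circ> g \<circ> finv \<gamma> \<in> S" using \<gamma> by (simp add: S_def)
    then show "\<exists>g\<in>S. \<exists>\<sigma>\<in>sq_units K. \<exists>\<tau>\<in>K. \<forall>\<^sub>F y in at_top. g y = s * y + (\<sigma> * b + \<tau> * (1 - s))"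
      using conjugate_end_germ [OF e(1) \<gamma>(1) g(1) top] by blast
  qed
  then show ?thesis by (auto simp: S_def)
qed

text \<open>The germ of \<open>f\<close> at \<open>x\<close> is the germ of an element of \<open>H\<close>. Arbitrary functions are allowed, so that
  germs can be composed without keeping track of global elements.\<close>

definition good :: "(real \<Rightarrow> real) \<Rightarrow> real \<Rightarrow> bool" where
  "good f x \<longleftrightarrow> (\<exists>h\<in>H. \<forall>\<^sub>F y in nhds x. h y = f y)"

lemma good_H: "h \<in> H \<Longrightarrow> good h x"
  unfolding good_def by (intro bexI [of _ h] always_eventually) auto

lemma good_cong:
  assumes "good f x" "\<forall>\<^sub>F y in nhds x. f y = g y"
  shows "good g x"
proof -
  obtain h where h: "h \<in> H" "\<forall>\<^sub>F y in nhds x. h y = f y" using assms(1) by (auto simp: good_def)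
  from h(2) assms(2) have "\<forall>\<^sub>F y in nhds x. h y = g y" by eventually_elim simp
  then show ?thesis using h(1) by (auto simp: good_def)
qed

lemma good_comp:
  assumes "good f x" "good g (f x)"
  shows "good (g \<circ> f) x"
proof -
  obtain h where h: "h \<in> H" "\<forall>\<^sub>F y in nhds x. h y = f y" using assms(1) by (auto simp: good_def)
  obtain k where k: "k \<in> H" "\<forall>\<^sub>F y in nhds (f x). k y = g y" using assms(2) by (auto simp: good_def)
  have "h x = f x" using eventually_nhds_x_imp_x [OF h(2)] .
  then have "filterlim h (nhds (f x)) (nhds x)"
    using G_filterlim(1) [OF H_in_G [OF h(1)], of x] by simp
  with k(2) have "\<forall>\<^sub>F y in nhds x. k (h y) = g (h y)"
    by (rule eventually_compose_filterlim)
  with h(2) have "\<forall>\<^sub>F y in nhds x. (k \<circ> h) y = (g \<circ> f) y" by eventually_elim simp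
  then show ?thesis using H_comp [OF k(1) h(1)] unfolding good_def by blast
qed

text \<open>Translate \<open>x\<close> by a large integer to where the germ at \<open>+\<infinity>\<close> is visible.\<close>

lemma good_end_germ:
  assumes "h \<in> H" "\<forall>\<^sub>F y in at_top. h y = s * y + b"
  shows "\<exists>n. good (\<lambda>y. s * y + (s * of_nat n + b)) x"
proof -
  obtain N where N: "\<And>y. y \<ge> N \<Longrightarrow> h y = s * y + b"
    using assms(2) by (auto simp: eventually_at_top_linorder)
  obtain n where n: "N - x < of_nat n" using reals_Archimedean2 by blast
  have "\<forall>\<^sub>F y in nhds x. N - of_nat n < y"
    using n by (intro order_tendstoD(1) [OF filterlim_ident]) simp
  then have "\<forall>\<^sub>F y in nhds x. (h \<circ> (\<lambda>y. y + of_nat n)) y = s * y + (s * of_nat n + b)"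
    by eventually_elim (simp add: N algebra_simps)
  then have "good (\<lambda>y. s * y + (s * of_nat n + b)) x"
    by (rule good_cong [OF good_H [OF H_comp [OF assms(1) H_nat_translation(1)]]])
  then show ?thesis ..
qed

lemma good_translation:
  assumes "b \<in> K" shows "good (\<lambda>y. y + b) x"
proof -
  obtain h where "h \<in> H" "\<forall>\<^sub>F y in at_top. h y = 1 * y + b"
    using H_germs_top [OF sq_units_1 assms] by blast
  then obtain n where n: "good (\<lambda>y. 1 * y + (1 * of_nat n + b)) x"
    using good_end_germ by blast
  have "good ((\<lambda>y. y - of_nat n) \<circ> (\<lambda>y. 1 * y + (1 * of_nat n + b))) x"
    by (rule good_comp [OF n good_H [OF H_nat_translation(2)]])
  then show ?thesis by (simp add: o_def)
qed

lemma good_affine: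
  assumes "s \<in> sq_units K" "b \<in> K" shows "good (\<lambda>y. s * y + b) x"
proof -
  obtain h where "h \<in> H" "\<forall>\<^sub>F y in at_top. h y = s * y + b"
    using H_germs_top [OF assms] by blast
  then obtain n where n: "good (\<lambda>y. s * y + (s * of_nat n + b)) x"
    using good_end_germ by blast
  have "- (s * of_nat n) \<in> K"
    using assms by (intro K_uminus K_mult sq_units_in K_of_nat)
  then have "good ((\<lambda>y. y + - (s * of_nat n)) \<circ> (\<lambda>y. s * y + (s * of_nat n + b))) x"
    by (intro good_comp [OF n good_translation])
  then show ?thesis by (simp add: o_def add.commute)
qed

text \<open>The heart of the argument. The element \<open>g\<close> below inserts \<open>\<gamma>\<close>, corrected by an integer translation, into
  an orbit of the translation by one. A conjugate of \<open>g\<close> in \<open>H\<close> still sees \<open>\<gamma>\<close> when points are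
  carried from near \<open>-\<infinity>\<close> to near \<open>+\<infinity>\<close>, because the conjugating element is affine at both ends.\<close>

lemma good_G:
  assumes "\<gamma> \<in> G" shows "good \<gamma> x"
proof -
  \<comment> \<open>The shift by \<open>k\<close> moves the image of \<open>x\<close> to the right of \<open>x\<close>, so that the translation by one can be
    left after \<open>x - 1\<close> and rejoined before that image.\<close>
  define k where "k = \<lceil>x + 1 - \<gamma> x\<rceil>"
  define y0 where "y0 = \<gamma> x + of_int k"
  have y0: "x + 1 \<le> y0"
    unfolding y0_def k_def by linarith
  define \<gamma>1 where "\<gamma>1 = (\<lambda>y. y + of_int k) \<circ> \<gamma>"
  note T = translation_G [OF K_1]
  have \<gamma>1: "\<gamma>1 \<in> G" "\<gamma>1 x = y0"
    using G_comp [OF translation_G [OF K_of_int] assms] by (auto simp: \<gamma>1_def y0_def)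
  obtain g1 a1 b1 where g1: "g1 \<in> G" "x - 1 < a1" "a1 < b1" "b1 < x"
    "\<And>t. t \<le> a1 \<Longrightarrow> g1 t = t + 1" "\<And>t. t \<ge> b1 \<Longrightarrow> g1 t = \<gamma>1 t"
    using connect [OF T \<gamma>1(1), of "x - 1" x] y0 \<gamma>1(2) by auto
  have "g1 x < y0 + 1" using g1 \<gamma>1(2) by simp
  moreover have "x < y0" using y0 by simp
  ultimately obtain g a2 b2 where g: "g \<in> G" "x < a2" "a2 < b2" "b2 < y0"
    "\<And>t. t \<le> a2 \<Longrightarrow> g t = g1 t" "\<And>t. t \<ge> b2 \<Longrightarrow> g t = t + 1"
    using connect [OF g1(1) T, of x y0] by blast
  obtain \<theta> where \<theta>: "\<theta> \<in> G" "\<theta> \<circ> g \<circ> finv \<theta> \<in> H" using H_meets [OF g(1)] by blast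
  obtain s1 c1 M1 where bot: "s1 \<in> sq_units K" "c1 \<in> K" "\<And>y. y \<le> M1 \<Longrightarrow> \<theta> y = s1 * y + c1"
    using G_D(7) [OF \<theta>(1)] by (auto simp: affine_at_def eventually_at_bot_linorder)
  obtain s2 c2 M2 where top: "s2 \<in> sq_units K" "c2 \<in> K" "\<And>y. y \<ge> M2 \<Longrightarrow> \<theta> y = s2 * y + c2"
    using G_D(6) [OF \<theta>(1)] by (auto simp: affine_at_def eventually_at_top_linorder)
  obtain N :: nat where N: "x - M1 < of_nat N" using reals_Archimedean2 by blast
  obtain m :: nat where m: "M2 - y0 < of_nat m" using reals_Archimedean2 by blast
  have pow1: "(g ^^ n) t = t + of_nat n" if "t + of_nat n \<le> a1 + 1" for n t
    using that
  proof (induction n)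
    case (Suc n)
    then have "t + of_nat n \<le> a1" by simp
    then show ?case using Suc g(5) [of "t + of_nat n"] g1 g(2) by simp
  qed simp
  have pow2: "(g ^^ n) t = t + of_nat n" if "t \<ge> b2" for n t
    using that by (induction n) (simp_all add: g(6))
  \<comment> \<open>\<open>N\<close> steps from near \<open>x - N\<close> to near \<open>x\<close>, one step that applies \<open>\<gamma>\<close>, and \<open>m\<close> steps to the right.\<close>
  define L where "L = m + Suc N"
  define h where "h = (\<theta> \<circ> g \<circ> finv \<theta>) ^^ L"
  have h: "h \<in> H" unfolding h_def by (rule H_funpow [OF \<theta>(2)])
  have "\<forall>\<^sub>F z in nhds x. z < a1 + 1" "\<forall>\<^sub>F z in nhds x. b1 < z" "\<forall>\<^sub>F z in nhds x. z < a2"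
      "\<forall>\<^sub>F z in nhds x. z < M1 + of_nat N"
    using g1 g N by (auto intro: order_tendstoD [OF filterlim_ident])
  moreover have "\<forall>\<^sub>F z in nhds x. b2 < \<gamma>1 z" "\<forall>\<^sub>F z in nhds x. M2 - of_nat m < \<gamma>1 z"
    using g(4) m \<gamma>1(2) by (auto intro!: order_tendstoD [OF G_filterlim(1) [OF \<gamma>1(1)]])
  ultimately have ev: "\<forall>\<^sub>F z in nhds x. h (s1 * z + (c1 - s1 * of_nat N)) = s2 * (\<gamma> z + of_int k + of_nat m) + c2"
  proof eventually_elim
    case (elim z)
    have "(g ^^ Suc N) (z - of_nat N) = \<gamma>1 z"
      using pow1 [of "z - of_nat N" N] elim g(5) [of z] g1(6) [of z] by simp
    then have "(g ^^ L) (z - of_nat N) = \<gamma>1 z + of_nat m"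
      using pow2 [of "\<gamma>1 z" m] elim unfolding L_def funpow_add by simp
    then have "h (\<theta> (z - of_nat N)) = \<theta> (\<gamma>1 z + of_nat m)"
      unfolding h_def using G_conj_funpow [OF \<theta>(1)] by simp
    then show ?case
      using bot(3) [of "z - of_nat N"] top(3) [of "\<gamma>1 z + of_nat m"] elim
      by (simp add: \<gamma>1_def algebra_simps)
  qed
  \<comment> \<open>The affine corrections: \<open>\<alpha>\<close> is \<open>\<theta>\<close> near \<open>-\<infinity>\<close> after the shift by \<open>-N\<close>, and \<open>\<beta>\<close> undoes \<open>\<theta>\<close> near
    \<open>+\<infinity>\<close> and the shifts by \<open>k\<close> and \<open>m\<close>.\<close>
  define \<alpha> where "\<alpha> = (\<lambda>z. s1 * z + (c1 - s1 * of_nat N))"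
  define \<beta> where "\<beta> = (\<lambda>w. inverse s2 * w + (- (inverse s2 * c2) - of_int k - of_nat m))"
  have s2: "s2 > 0" using top(1) by (rule sq_unitsD)
  have "good \<alpha> x"
    unfolding \<alpha>_def using good_affine [OF bot(1) K_diff [OF bot(2) K_mult [OF sq_units_in [OF bot(1)] K_of_nat]]] .
  moreover have "good \<beta> w" for w
  proof -
    have "inverse s2 * c2 \<in> K"
      using K_mult [OF sq_units_in [OF sq_units_inverse [OF top(1)]] top(2)] .
    then show ?thesis
      unfolding \<beta>_def by (intro good_affine sq_units_inverse top(1) K_diff K_uminus K_of_nat K_of_int)
  qed
  ultimately have "good (\<beta> \<circ> (h \<circ> \<alpha>)) x"
    using good_comp [OF good_comp [OF _ good_H [OF h]]] by blast
  moreover have "\<forall>\<^sub>F z in nhds x. (\<beta> \<circ> (h \<circ> \<alpha>)) z = \<gamma> z"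
    using ev by eventually_elim (use s2 in \<open>simp add: \<alpha>_def \<beta>_def field_simps\<close>)
  ultimately show ?thesis by (rule good_cong)
qed

text \<open>Conjugates of the pushing element are pushing elements at an unknown place. The place can be
  corrected within \<open>H\<close>, since by \<open>good_G\<close> the orbits of \<open>H\<close> are the orbits of \<open>G\<close>.\<close>

lemma H_push:
  assumes "u < v"
  shows "\<exists>\<psi>\<in>H. \<exists>w. u < w \<and> w < v \<and> (\<forall>t\<ge>w. \<psi> t = t) \<and> u < \<psi> a"
proof -
  obtain p w0 where p: "p \<in> G" "\<And>t. t < w0 \<Longrightarrow> p t > t" "\<And>t. t \<ge> w0 \<Longrightarrow> p t = t"
    using push_element by blast
  obtain g where g: "g \<in> G" "u < g w0" "g w0 < v" using move_into [OF assms] by blast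
  define p1 where "p1 = g \<circ> p \<circ> finv g"
  have "p1 \<in> G" unfolding p1_def using p g by (intro G_comp G_inv_mem)
  then obtain \<gamma> where \<gamma>: "\<gamma> \<in> G" "\<gamma> \<circ> p1 \<circ> finv \<gamma> \<in> H" using H_meets by blast
  obtain f where f: "f \<in> H" "\<forall>\<^sub>F y in nhds (\<gamma> (g w0)). f y = finv \<gamma> y"
    using good_G [OF G_inv_mem [OF \<gamma>(1)]] by (auto simp: good_def)
  have fw: "f (\<gamma> (g w0)) = g w0"
    using eventually_nhds_x_imp_x [OF f(2)] \<gamma>(1) by simp
  define \<theta> where "\<theta> = f \<circ> \<gamma> \<circ> g"
  have \<theta>: "\<theta> \<in> G" unfolding \<theta>_def using f(1) \<gamma>(1) g(1) H_in_G by (intro G_comp) auto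
  define \<psi> where "\<psi> = f \<circ> (\<gamma> \<circ> p1 \<circ> finv \<gamma>) \<circ> finv f"
  have \<psi>: "\<psi> \<in> H" unfolding \<psi>_def by (rule H_comp [OF H_comp [OF f(1) \<gamma>(2)] H_inv [OF f(1)]])
  define w where "w = g w0"
  have \<theta>w: "\<theta> w0 = w" using fw by (simp add: \<theta>_def w_def)
  have conj: "\<psi> (\<theta> z) = \<theta> (p z)" for z
    using H_in_G [OF f(1)] \<gamma>(1) g(1) by (simp add: \<psi>_def \<theta>_def p1_def)
  have fixed: "\<psi> t = t" if "t \<ge> w" for t
  proof -
    have "\<theta> (finv \<theta> t) \<ge> \<theta> w0" using that \<theta> \<theta>w by simp
    then have "finv \<theta> t \<ge> w0" using G_le [OF \<theta>] by blast
    then show ?thesis using conj [of "finv \<theta> t"] p(3) \<theta> by simp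
  qed
  have up: "\<psi> t > t" if "t < w" for t
  proof -
    have "\<theta> (finv \<theta> t) < \<theta> w0" using that \<theta> \<theta>w by simp
    then have "finv \<theta> t < w0" using G_less [OF \<theta>] by blast
    then have "\<theta> (finv \<theta> t) < \<theta> (p (finv \<theta> t))" using p(2) G_less [OF \<theta>] by blast
    then show ?thesis using conj [of "finv \<theta> t"] \<theta> by simp
  qed
  have "u < w" "w < v" using g by (simp_all add: w_def)
  obtain n where "u < (\<psi> ^^ n) a"
    using exceeds_by_iteration [of \<psi> w u a] G_isCont [OF H_in_G [OF \<psi>]] up \<open>u < w\<close> by blast
  moreover have "(\<psi> ^^ n) t = t" if "t \<ge> w" for t
    using that fixed by (induction n) auto
  ultimately show ?thesis
    using H_funpow [OF \<psi>, of n] \<open>u < w\<close> \<open>w < v\<close> by blast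
qed

text \<open>Conjugation by \<open>\<psi>\<close> pulls back to all of \<open>[a, w]\<close> the interval on which \<open>k\<close> is trivial, and it does
  nothing where \<open>\<psi>\<close> is trivial.\<close>

lemma H_cut:
  assumes k: "k \<in> H" and uv: "u < v" and id: "\<And>t. u \<le> t \<Longrightarrow> t \<le> v \<Longrightarrow> k t = t"
  shows "\<exists>k'\<in>H. \<exists>w. u < w \<and> w < v \<and> (\<forall>t. a \<le> t \<longrightarrow> t \<le> w \<longrightarrow> k' t = t) \<and> (\<forall>t\<ge>w. k' t = k t)"
proof -
  obtain \<psi> w where \<psi>: "\<psi> \<in> H" "u < w" "w < v" "\<And>t. t \<ge> w \<Longrightarrow> \<psi> t = t" "u < \<psi> a"
    using H_push [OF uv, of a] by blast
  note G = H_in_G [OF \<psi>(1)] H_in_G [OF k]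
  define k' where "k' = finv \<psi> \<circ> k \<circ> \<psi>"
  have "k' \<in> H" unfolding k'_def using \<psi>(1) k by (intro H_comp H_inv)
  moreover have "k' t = t" if "a \<le> t" "t \<le> w" for t
  proof -
    have "\<psi> a \<le> \<psi> t" "\<psi> t \<le> \<psi> w" using that G_le [OF G(1)] by auto
    then have "k (\<psi> t) = \<psi> t" using \<psi>(2-5) by (intro id) auto
    then show ?thesis using G by (simp add: k'_def)
  qed
  moreover have "k' t = k t" if "t \<ge> w" for t
  proof -
    have "k w = w" using \<psi> by (intro id) auto
    then have "k t \<ge> w" using that G_le [OF G(2), of w t] by simp
    then have "\<psi> (k t) = k t" by (rule \<psi>(4))
    then have "finv \<psi> (k t) = k t" using G_inv(1) [OF G(1), of "k t"] by simp
    then show ?thesis using \<psi>(4) [OF that] by (simp add: k'_def)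
  qed
  ultimately show ?thesis using \<psi> by blast
qed

text \<open>Subdivision of the interval: the property used in the bisection includes a margin \<open>e\<close> on both
  sides, so that adjacent pieces overlap in an interval on which \<open>h1\<inverse> h2\<close> is trivial and can be cut.\<close>

lemma H_approximates:
  assumes "\<gamma> \<in> G" "a \<le> b"
  shows "\<exists>h\<in>H. \<forall>t\<in>{a..b}. h t = \<gamma> t"
proof -
  let ?P = "\<lambda>a b. \<exists>h\<in>H. \<exists>e>0. \<forall>t. a - e < t \<longrightarrow> t < b + e \<longrightarrow> h t = \<gamma> t"
  have "?P a b"
    using \<open>a \<le> b\<close>
  proof (induction rule: Bolzano)
    case (trans a b c)
    obtain h1 e1 where h1: "h1 \<in> H" "e1 > 0" "\<And>t. a - e1 < t \<Longrightarrow> t < b + e1 \<Longrightarrow> h1 t = \<gamma> t"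
      using trans(1) by blast
    obtain h2 e2 where h2: "h2 \<in> H" "e2 > 0" "\<And>t. b - e2 < t \<Longrightarrow> t < c + e2 \<Longrightarrow> h2 t = \<gamma> t"
      using trans(2) by blast
    define e where "e = min e1 e2 / 2"
    have e: "e > 0" "e < e1" "e < e2" using h1 h2 by (auto simp: e_def)
    define k where "k = finv h1 \<circ> h2"
    have k: "k \<in> H" unfolding k_def using h1 h2 by (intro H_comp H_inv)
    have "k t = t" if "b - e \<le> t" "t \<le> b + e" for t
    proof -
      have "h2 t = h1 t" using h1(3) [of t] h2(3) [of t] that e trans(3,4) by simp
      then show ?thesis using H_in_G [OF h1(1)] by (simp add: k_def)
    qed
    then obtain k' w where k': "k' \<in> H" "b - e < w" "w < b + e" "\<And>t. a - e \<le> t \<Longrightarrow> t \<le> w \<Longrightarrow> k' t = t"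
      "\<And>t. t \<ge> w \<Longrightarrow> k' t = k t"
      using H_cut [OF k, of "b - e" "b + e" "a - e"] e by auto
    have "(h1 \<circ> k') t = \<gamma> t" if "a - e < t" "t < c + e" for t
    proof (cases "t \<le> w")
      case True
      then show ?thesis using k' that e h1(3) [of t] by simp
    next
      case False
      then show ?thesis using k' that e h2(3) [of t] H_in_G [OF h1(1)] by (simp add: k_def)
    qed
    then show ?case using H_comp [OF h1(1) k'(1)] e by blast
  next
    case (local x)
    obtain h where h: "h \<in> H" "\<forall>\<^sub>F y in nhds x. h y = \<gamma> y"
      using good_G [OF assms(1), of x] by (auto simp: good_def)
    then obtain d where d: "d > 0" "\<And>y. dist y x < d \<Longrightarrow> h y = \<gamma> y"
      by (auto simp: eventually_nhds_metric)
    have "?P a b" if "a \<le> x" "x \<le> b" "b - a < d / 2" for a b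
      using h(1) d that by (intro bexI [of _ h] exI [of _ "d/2"]) (auto simp: dist_real_def)
    then show ?case using d(1) by (intro exI [of _ "d/2"]) auto
  qed
  then obtain h e where "h \<in> H" "e > 0" "\<And>t. a - e < t \<Longrightarrow> t < b + e \<Longrightarrow> h t = \<gamma> t" by blast
  then show ?thesis by (intro bexI [of _ h]) auto
qed

text \<open>If \<open>h\<close> agrees with the conjugating element on the support, conjugating back by \<open>h\<close> recovers \<open>g\<close>.\<close>

lemma compactly_supported_H:
  assumes g: "g \<in> G" and ab: "a \<le> b" and supp: "\<And>t. t < a \<or> b < t \<Longrightarrow> g t = t"
  shows "g \<in> H"
proof -
  obtain \<gamma> where \<gamma>: "\<gamma> \<in> G" "\<gamma> \<circ> g \<circ> finv \<gamma> \<in> H" using H_meets [OF g] by blast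
  obtain h where h: "h \<in> H" "\<And>t. a - 1 \<le> t \<Longrightarrow> t \<le> b + 1 \<Longrightarrow> h t = \<gamma> t"
    using H_approximates [OF \<gamma>(1), of "a - 1" "b + 1"] ab by auto
  note hG = H_in_G [OF h(1)]
  have "finv h \<circ> (\<gamma> \<circ> g \<circ> finv \<gamma>) \<circ> h = g"
  proof
    fix t
    define z where "z = finv \<gamma> (h t)"
    have z: "\<gamma> z = h t" using \<gamma>(1) by (simp add: z_def)
    have ends: "\<gamma> (a - 1) = h (a - 1)" "\<gamma> (b + 1) = h (b + 1)" using h(2) ab by simp_all
    have "finv h (\<gamma> (g z)) = g t"
    proof (cases "a - 1 \<le> t \<and> t \<le> b + 1")
      case True
      then have "\<gamma> z = \<gamma> t" using z h(2) by simp
      then have "z = t" using G_inj [OF \<gamma>(1)] by (simp add: inj_eq)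
      have "g (a - 1) \<le> g t" "g t \<le> g (b + 1)" using True by (simp_all add: G_le [OF g])
      then have "\<gamma> (g t) = h (g t)" using supp h(2) by simp
      then show ?thesis using \<open>z = t\<close> hG by simp
    next
      case False
      then have "h t < h (a - 1) \<or> h (b + 1) < h t" by (auto simp: G_less [OF hG])
      then have "z < a - 1 \<or> b + 1 < z"
        using z ends G_less [OF \<gamma>(1), of z "a - 1"] G_less [OF \<gamma>(1), of "b + 1" z] by simp
      then have "g z = z" using supp by auto
      moreover have "g t = t" using False supp by auto
      ultimately show ?thesis using z hG by simp
    qed
    then show "(finv h \<circ> (\<gamma> \<circ> g \<circ> finv \<gamma>) \<circ> h) t = g t"
      by (simp add: z_def)
  qed
  then show ?thesis using H_comp [OF H_comp [OF H_inv [OF h(1)] \<gamma>(2)] h(1)] by simp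
qed

theorem H_eq_G: "H = G"
proof
  show "G \<subseteq> H"
  proof
    fix f assume f: "f \<in> G"
    obtain s b where sb: "s \<in> sq_units K" "b \<in> K" "\<forall>\<^sub>F y in at_bot. f y = s * y + b"
      using G_D(7) [OF f] by (auto simp: affine_at_def)
    obtain h1 where h1: "h1 \<in> H" "\<forall>\<^sub>F y in at_bot. h1 y = s * y + b"
      using H_germs_bot [OF sb(1,2)] by blast
    define f1 where "f1 = finv h1 \<circ> f"
    have f1: "f1 \<in> G" unfolding f1_def by (rule G_comp [OF G_inv_mem [OF H_in_G [OF h1(1)]] f])
    from sb(3) h1(2) have bot1: "\<forall>\<^sub>F y in at_bot. f1 y = y"
      by eventually_elim (metis G_inv(1) H_in_G comp_apply f1_def h1(1))
    obtain s2 b2 where sb2: "s2 \<in> sq_units K" "b2 \<in> K" "\<forall>\<^sub>F y in at_top. f1 y = s2 * y + b2"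
      using G_D(6) [OF f1] by (auto simp: affine_at_def)
    obtain h2 where h2: "h2 \<in> H" "\<forall>\<^sub>F y in at_bot. h2 y = y" "\<forall>\<^sub>F y in at_top. h2 y = s2 * y + b2"
      using H_germs_top [OF sb2(1,2)] by blast
    define f2 where "f2 = finv h2 \<circ> f1"
    have f2: "f2 \<in> G" unfolding f2_def by (rule G_comp [OF G_inv_mem [OF H_in_G [OF h2(1)]] f1])
    from bot1 h2(2) have "\<forall>\<^sub>F y in at_bot. f2 y = y"
      by eventually_elim (metis G_inv(1) H_in_G comp_apply f2_def h2(1))
    then obtain a where a: "\<And>y. y \<le> a \<Longrightarrow> f2 y = y" by (auto simp: eventually_at_bot_linorder)
    from sb2(3) h2(3) have "\<forall>\<^sub>F y in at_top. f2 y = y"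
      by eventually_elim (metis G_inv(1) H_in_G comp_apply f2_def h2(1))
    then obtain b where b: "\<And>y. y \<ge> b \<Longrightarrow> f2 y = y" by (auto simp: eventually_at_top_linorder)
    have "f2 \<in> H"
      by (rule compactly_supported_H [OF f2, of a "max a b"]) (use a b in auto)
    then have "h1 \<circ> (h2 \<circ> f2) \<in> H" using h1(1) h2(1) by (intro H_comp)
    moreover have "h1 \<circ> (h2 \<circ> f2) = f"
      using H_in_G [OF h1(1)] H_in_G [OF h2(1)] by (auto simp: f1_def f2_def)
    ultimately show "f \<in> H" by simp
  qed
qed (rule H_G)

end

section \<open>Existence of bridges\<close>

text \<open>One-sided neighbourhoods of \<open>x\<close> and \<open>y\<close> on which the maps have no pole and keep their order.\<close>

lemma bridge_room:
  assumes A: "A \<in> sl K" "den A x \<noteq> 0" and B: "B \<in> sl K" "den B y \<noteq> 0"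
    and xy: "x < y" "mob A x < mob B y" "0 < \<delta>"
  obtains x1 y1 where "x < x1" "x1 < x + \<delta>" "y - \<delta> < y1" "y1 < y" "x1 < y1" "mob A x1 < mob B y1"
    "\<And>s t. x \<le> s \<Longrightarrow> s \<le> x1 \<Longrightarrow> x \<le> t \<Longrightarrow> t \<le> x1 \<Longrightarrow> den A s * den A t > 0"
    "\<And>s t. y1 \<le> s \<Longrightarrow> s \<le> y \<Longrightarrow> y1 \<le> t \<Longrightarrow> t \<le> y \<Longrightarrow> den B s * den B t > 0"
proof -
  define m where "m = (mob A x + mob B y) / 2"
  have m: "mob A x < m" "m < mob B y" using xy by (simp_all add: m_def)
  have same_sign: "a * b > 0" if "a * c > 0" "b * c > 0" for a b c :: real
    using that by (auto simp: zero_less_mult_iff)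
  have "\<forall>\<^sub>F t in nhds x. mob A t < m"
    using isCont_mob [OF A(2)] m(1) by (intro order_tendstoD(2)) (auto simp: isCont_def tendsto_at_iff_tendsto_nhds)
  with eventually_den [OF A(2)] have "\<forall>\<^sub>F t in nhds x. den A t * den A x > 0 \<and> mob A t < m"
    by eventually_elim simp
  then obtain d1 where d1: "d1 > 0" "\<And>t. dist t x < d1 \<Longrightarrow> den A t * den A x > 0 \<and> mob A t < m"
    by (auto simp: eventually_nhds_metric)
  have "\<forall>\<^sub>F t in nhds y. m < mob B t"
    using isCont_mob [OF B(2)] m(2) by (intro order_tendstoD(1)) (auto simp: isCont_def tendsto_at_iff_tendsto_nhds)
  with eventually_den [OF B(2)] have "\<forall>\<^sub>F t in nhds y. den B t * den B y > 0 \<and> m < mob B t"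
    by eventually_elim simp
  then obtain d2 where d2: "d2 > 0" "\<And>t. dist t y < d2 \<Longrightarrow> den B t * den B y > 0 \<and> m < mob B t"
    by (auto simp: eventually_nhds_metric)
  define e where "e = min (min d1 d2) (min \<delta> (y - x)) / 3"
  have "3 * e \<le> d1" "3 * e \<le> d2" "3 * e \<le> \<delta>" "3 * e \<le> y - x" "0 < 3 * e"
    using d1(1) d2(1) xy by (simp_all add: e_def)
  then have e: "0 < e" "e < d1" "e < d2" "e < \<delta>" "3 * e \<le> y - x"
    by linarith+
  show ?thesis
  proof (rule that [of "x + e" "y - e"])
    show "mob A (x + e) < mob B (y - e)"
      using d1(2) [of "x + e"] d2(2) [of "y - e"] e by (simp add: dist_real_def)
    show "den A s * den A t > 0" if "x \<le> s" "s \<le> x + e" "x \<le> t" "t \<le> x + e" for s t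
      by (rule same_sign [of _ "den A x"]) (use d1(2) [of s] d1(2) [of t] that e in \<open>simp_all add: dist_real_def\<close>)
    show "den B s * den B t > 0" if "y - e \<le> s" "s \<le> y" "y - e \<le> t" "t \<le> y" for s t
      by (rule same_sign [of _ "den B y"]) (use d2(2) [of s] d2(2) [of t] that e in \<open>simp_all add: dist_real_def\<close>)
  qed (use e in simp_all)
qed

text \<open>The matrix represents the map that sends \<open>u + h\<close> to \<open>w + h / (\<alpha> h + t\<^sup>2)\<close>, normalised to determinant
  one; the constant term in the denominator has to be a square for this. The coefficient \<open>\<alpha>\<close> is
  forced by \<open>v \<mapsto> z\<close>, and it is positive when \<open>t\<close> is small, which puts the pole to the left of \<open>u\<close>.\<close>

lemma bridge_matrix:
  fixes u v w z t :: real
  assumes uv: "u < v" "w < z" and t: "0 < t" "t\<^sup>2 * (z - w) < v - u"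
  defines "\<alpha> \<equiv> ((v - u) / (z - w) - t\<^sup>2) / (v - u)"
  defines "C \<equiv> matrix_2x2 (1 / t + w * (\<alpha> / t)) (- u / t + w * (t - \<alpha> * u / t)) (\<alpha> / t) (t - \<alpha> * u / t)"
  shows "C$1$1 * C$2$2 - C$1$2 * C$2$1 = 1" "C$2$1 > 0" "den C u > 0" "mob C u = w" "mob C v = z"
proof -
  have "t\<^sup>2 < (v - u) / (z - w)" using t(2) uv by (simp add: pos_less_divide_eq)
  then have \<alpha>: "\<alpha> > 0" using uv by (simp add: \<alpha>_def)
  then show "C$2$1 > 0" using t by (simp add: C_def)
  have du: "den C u = t" by (simp add: C_def den_def)
  then show "den C u > 0" using t by simp
  show "C$1$1 * C$2$2 - C$1$2 * C$2$1 = 1"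
    using t(1) by (simp add: C_def field_simps)
  have num: "C$1$1 * y + C$1$2 = w * den C y + (y - u) / t" for y
    using t(1) by (simp add: C_def den_def field_simps)
  show "mob C u = w"
    unfolding mob_def num using du t(1) by simp
  have \<alpha>v: "\<alpha> * (v - u) = (v - u) / (z - w) - t\<^sup>2" using uv by (simp add: \<alpha>_def)
  have "den C v = (\<alpha> * (v - u) + t\<^sup>2) / t"
    using t(1) by (simp add: C_def den_def field_simps power2_eq_square)
  also have "\<dots> = (v - u) / (z - w) / t" by (simp add: \<alpha>v)
  finally have dv: "den C v = (v - u) / (z - w) / t" .
  have "(v - u) / t / den C v = z - w"
    using t(1) uv unfolding dv by simp
  moreover have "den C v \<noteq> 0" using t(1) uv unfolding dv by simp
  ultimately show "mob C v = z"
    unfolding mob_def num by (simp add: add_divide_distrib)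
qed

text \<open>Over a field the end points may be any rational points near \<open>x\<close> and \<open>y\<close>, since the values there
  lie in \<open>K\<close> again.\<close>

lemma (in subring_of_reals) bridge_field:
  assumes inverse: "\<And>a. a \<in> K \<Longrightarrow> inverse a \<in> K" and rat: "\<rat> \<subseteq> K"
    and A: "A \<in> sl K" "den A x \<noteq> 0" and B: "B \<in> sl K" "den B y \<noteq> 0"
    and xy: "x < y" "mob A x < mob B y" "0 < \<delta>"
  shows "\<exists>C\<in>sl K. \<exists>u\<in>K. \<exists>v\<in>K. x < u \<and> u < x + \<delta> \<and> y - \<delta> < v \<and> v < y \<and> u < v \<and>
        C$2$1 > 0 \<and> den C u > 0 \<and> mob C u = mob A u \<and> mob C v = mob B v"
proof -
  obtain x1 y1 where r: "x < x1" "x1 < x + \<delta>" "y - \<delta> < y1" "y1 < y" "x1 < y1" "mob A x1 < mob B y1"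
    "\<And>s t. x \<le> s \<Longrightarrow> s \<le> x1 \<Longrightarrow> x \<le> t \<Longrightarrow> t \<le> x1 \<Longrightarrow> den A s * den A t > 0"
    "\<And>s t. y1 \<le> s \<Longrightarrow> s \<le> y \<Longrightarrow> y1 \<le> t \<Longrightarrow> t \<le> y \<Longrightarrow> den B s * den B t > 0"
    using bridge_room [OF A B xy] by blast
  obtain u where u: "u \<in> \<rat>" "x < u" "u < x1" using Rats_dense_in_real [OF r(1)] by blast
  obtain v where v: "v \<in> \<rat>" "y1 < v" "v < y" using Rats_dense_in_real [OF r(4)] by blast
  have divide: "a / b \<in> K" if "a \<in> K" "b \<in> K" for a b
    using K_mult [OF that(1) inverse [OF that(2)]] by (simp add: divide_inverse)
  have mobK: "mob M z \<in> K" if "M \<in> sl K" "z \<in> K" for M z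
    using that by (auto simp: mob_def den_def sl_iff intro!: divide K_add K_mult)
  define w where "w = mob A u"
  define z where "z = mob B v"
  have K: "u \<in> K" "v \<in> K" "w \<in> K" "z \<in> K"
    using u v rat mobK A B by (auto simp: w_def z_def)
  have "mob A u < mob A x1" "mob B y1 < mob B v"
    using u v r by (auto intro!: mob_less [OF A(1)] mob_less [OF B(1)])
  then have wz: "w < z" using r(6) by (simp add: w_def z_def)
  have uv: "u < v" using u v r by simp
  define \<rho> where "\<rho> = sqrt ((v - u) / (z - w))"
  have "\<rho> > 0" using uv wz by (simp add: \<rho>_def)
  then obtain t where t: "t \<in> \<rat>" "0 < t" "t < \<rho>" using Rats_dense_in_real by blast
  have "t\<^sup>2 < \<rho>\<^sup>2" using t by (intro power_strict_mono) auto
  then have "t\<^sup>2 * (z - w) < v - u" using uv wz by (simp add: \<rho>_def pos_less_divide_eq)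
  note C = bridge_matrix [OF uv wz t(2) this]
  have tK: "t \<in> K" using t rat by auto
  show ?thesis
    by (rule bexI [OF _ ], rule bexI [of _ u], rule bexI [of _ v])
      (use C K tK u v r uv in \<open>auto simp: sl_iff w_def [symmetric] z_def [symmetric] power2_eq_square
        intro!: divide K_add K_mult K_uminus K_diff\<close>)
qed

lemma P_Z_I:
  assumes "M \<in> sl \<int>" "\<bar>trace M\<bar> > 2" "den M x \<noteq> 0" "mob M x = x"
  shows "x \<in> P_Z"
proof -
  have "trace (- M) = - trace M" by (simp add: trace_def sum_2)
  then have "{M, - M} \<in> carrier (PSL2 \<int>)" "hyperbolic {M, - M}" "mobius {M, - M} (Some x) = Some x"
    using assms by (auto simp: carrier_PSL2 hyperbolic_def mobius_coset mob_Some)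
  then show ?thesis unfolding P_Z_def by blast
qed

lemma P_Z_E:
  assumes "x \<in> P_Z"
  obtains M where "M \<in> sl \<int>" "\<bar>trace M\<bar> > 2" "den M x \<noteq> 0" "mob M x = x"
proof -
  obtain M where M: "M \<in> sl \<int>" "hyperbolic {M, - M}" "mobius {M, - M} (Some x) = Some x"
    using assms by (auto simp: P_Z_def carrier_PSL2)
  then show ?thesis using that [of M]
    by (auto simp: hyperbolic_def mobius_coset mob_Some split: if_splits)
qed

lemma eventually_linear_gt:
  fixes a b c :: real
  assumes "a > 0" shows "\<forall>\<^sub>F n in sequentially. c < real n * a + b"
proof -
  obtain N :: nat where N: "(c - b) / a < real N" using reals_Archimedean2 by blast
  have "c < real n * a + b" if "N \<le> n" for n
  proof -
    have "(c - b) / a < real n" using N that by simp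
    then show ?thesis using assms by (simp add: pos_divide_less_eq)
  qed
  then show ?thesis by (auto simp: eventually_sequentially)
qed

lemma eventually_linear_abs_gt:
  fixes a b c :: real
  assumes "a \<noteq> 0" shows "\<forall>\<^sub>F n in sequentially. c < \<bar>real n * a + b\<bar>"
proof (cases "a > 0")
  case True
  show ?thesis using eventually_linear_gt [OF True, of c b] by eventually_elim simp
next
  case False
  then have "- a > 0" using assms by simp
  from eventually_linear_gt [OF this, of c "- b"] show ?thesis by eventually_elim simp
qed

interpretation ints: subring_of_reals "\<int>"
  by unfold_locales auto

text \<open>Choose rationals \<open>\<sigma>\<close> slightly above \<open>x\<close> and \<open>\<rho>\<close> slightly below \<open>mob B y\<close>, an integral matrix \<open>M2\<close>
  sending \<open>\<sigma>\<close> to \<open>\<infinity>\<close> and an integral matrix \<open>M1\<close> sending \<open>\<infinity>\<close> to \<open>\<rho>\<close>. For large \<open>n\<close> the map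
  \<open>M1 T\<^sup>n M2\<close> has its pole just to the right of \<open>\<sigma>\<close>, climbs steeply from \<open>-\<infinity>\<close> and stays slightly below
  the value \<open>\<rho>\<close> from then on. Therefore it crosses the graph of \<open>mob A\<close> near \<open>x\<close> and that of \<open>mob B\<close>
  near \<open>y\<close>. A crossing with \<open>mob A\<close> is a fixed point of \<open>A\<inverse> M1 T\<^sup>n M2\<close>, which is hyperbolic for
  large \<open>n\<close>: its trace is an affine function of \<open>n\<close>, with nonzero slope because \<open>A\<close> does not send
  \<open>\<sigma>\<close> to \<open>\<rho>\<close>. The same applies to \<open>B\<close>.\<close>

lemma bridge_int:
  assumes A: "A \<in> sl \<int>" "den A x \<noteq> 0" and B: "B \<in> sl \<int>" "den B y \<noteq> 0"
    and xy: "x < y" "mob A x < mob B y" "0 < \<delta>"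
  shows "\<exists>C\<in>sl \<int>. \<exists>u\<in>P_Z. \<exists>v\<in>P_Z. x < u \<and> u < x + \<delta> \<and> y - \<delta> < v \<and> v < y \<and> u < v \<and>
        C$2$1 > 0 \<and> den C u > 0 \<and> mob C u = mob A u \<and> mob C v = mob B v"
proof -
  obtain x1 y1 where r: "x < x1" "x1 < x + \<delta>" "y - \<delta> < y1" "y1 < y" "x1 < y1" "mob A x1 < mob B y1"
    "\<And>s t. x \<le> s \<Longrightarrow> s \<le> x1 \<Longrightarrow> x \<le> t \<Longrightarrow> t \<le> x1 \<Longrightarrow> den A s * den A t > 0"
    "\<And>s t. y1 \<le> s \<Longrightarrow> s \<le> y \<Longrightarrow> y1 \<le> t \<Longrightarrow> t \<le> y \<Longrightarrow> den B s * den B t > 0"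
    using bridge_room [OF A B xy] by blast
  have denA: "den A t \<noteq> 0" if "x \<le> t" "t \<le> x1" for t using r(7) [OF that that] by auto
  have denB: "den B t \<noteq> 0" if "y1 \<le> t" "t \<le> y" for t using r(8) [OF that that] by auto
  have contA: "continuous_on {a..x1} (mob A)" if "x \<le> a" for a
    using that denA by (intro continuous_at_imp_continuous_on ballI isCont_mob) auto
  have contB: "continuous_on {y1..y} (mob B)"
    using denB by (intro continuous_at_imp_continuous_on ballI isCont_mob) auto
  have "mob B y1 < mob B y" using r by (intro mob_less [OF B(1)]) auto
  then obtain \<rho> where \<rho>: "\<rho> \<in> \<rat>" "mob B y1 < \<rho>" "\<rho> < mob B y" using Rats_dense_in_real by blast
  obtain \<sigma> where \<sigma>: "\<sigma> \<in> \<rat>" "x < \<sigma>" "\<sigma> < x1" using Rats_dense_in_real [OF r(1)] by blast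
  obtain p q :: int where pq: "q > 0" "coprime p q" "\<rho> = of_int p / of_int q"
    using \<rho>(1) by (rule Rats_cases')
  obtain p' q' :: int where pq': "q' > 0" "coprime p' q'" "\<sigma> = of_int p' / of_int q'"
    using \<sigma>(1) by (rule Rats_cases')
  obtain f e0 where "f * p + e0 * q = 1" using bezout_int [of p q] pq(2) by auto
  then obtain e f :: int where ef: "p * f - e * q = 1" 
    by (metis add.commute diff_minus_eq_add mult.commute mult_minus_left)
  obtain e0 f0 where "e0 * p' + f0 * q' = 1" using bezout_int [of p' q'] pq'(2) by auto
  then obtain e' f' :: int where ef': "- e' * p' - f' * q' = 1"
    by (metis diff_minus_eq_add minus_minus mult_minus_left)
  define M1 where "M1 = matrix_2x2 (of_int p) (of_int e) (of_int q) (of_int f)"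
  define M2 where "M2 = matrix_2x2 (of_int e') (of_int f') (of_int q') (- of_int p')"
  define C where "C n = M1 ** (matrix_2x2 1 (real n) 0 1 ** M2)" for n
  have "real_of_int (p * f - e * q) = 1" unfolding ef by simp
  then have M1: "M1 \<in> sl \<int>" by (simp add: M1_def sl_iff)
  have "real_of_int (- e' * p' - f' * q') = 1" unfolding ef' by simp
  then have M2: "M2 \<in> sl \<int>" by (simp add: M2_def sl_iff)
  have C: "C n \<in> sl \<int>" for n
    unfolding C_def using M1 M2 by (intro ints.sl_mult) (simp_all add: sl_iff)
  define \<beta> where "\<beta> z = of_int q' * (z - \<sigma>)" for z
  have q: "real_of_int q > 0" "real_of_int q' > 0" using pq pq' by simp_all
  have p: "real_of_int p = \<rho> * of_int q" "real_of_int p' = \<sigma> * of_int q'"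
    using q unfolding pq(3) pq'(3) by simp_all
  have \<beta>: "\<beta> z > 0" if "\<sigma> < z" for z using that q by (simp add: \<beta>_def)
  define \<kappa> where "\<kappa> z = of_int q * (of_int e' * z + of_int f') + of_int f * \<beta> z" for z
  \<comment> \<open>Everything is linear in \<open>n\<close>; the coefficient vanishes at \<open>\<sigma>\<close> and is positive to its right.\<close>
  have den: "den (C n) z = real n * (of_int q * \<beta> z) + \<kappa> z" for n z
    by (simp add: C_def M1_def M2_def den_def matrix_mult_nth_2 \<beta>_def \<kappa>_def p algebra_simps)
  have num: "of_int q * (C n $1$1 * z + C n $1$2) = of_int p * den (C n) z - \<beta> z" for n z
  proof -
    have "of_int q * (C n $1$1 * z + C n $1$2) - of_int p * den (C n) z
        = - \<beta> z * of_int (p * f - e * q)"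
      by (simp add: C_def M1_def M2_def den_def matrix_mult_nth_2 \<beta>_def p algebra_simps)
    then show ?thesis unfolding ef by simp
  qed
  have mob: "mob (C n) z = \<rho> - \<beta> z / (of_int q * den (C n) z)" if "den (C n) z \<noteq> 0" for n z
  proof -
    have "C n $1$1 * z + C n $1$2 = \<rho> * den (C n) z - \<beta> z / of_int q"
      using num [of n z] q unfolding p by (simp add: field_simps)
    then show ?thesis using that by (simp add: mob_def diff_divide_distrib)
  qed
  have den_large: "\<forall>\<^sub>F n in sequentially. c < den (C n) z" if "\<sigma> < z" for c z
    unfolding den by (rule eventually_linear_gt) (use \<beta> [OF that] q in simp)
  have close: "\<forall>\<^sub>F n in sequentially. c < mob (C n) z" if "\<sigma> < z" "c < \<rho>" for c z
    using den_large [OF that(1), of 0] den_large [OF that(1), of "\<beta> z / (of_int q * (\<rho> - c))"]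
  proof eventually_elim
    case (elim n)
    then have "\<beta> z < den (C n) z * (of_int q * (\<rho> - c))"
      using q that by (simp add: pos_divide_less_eq)
    then have "\<beta> z < (\<rho> - c) * (of_int q * den (C n) z)"
      by (simp only: mult_ac)
    then have "\<beta> z / (of_int q * den (C n) z) < \<rho> - c"
      using q elim by (simp only: pos_divide_less_eq mult_pos_pos)
    then show ?case using mob elim by simp
  qed
  have tr: "trace (adj M ** C n) = real n * (of_int q * of_int q' * (\<rho> * den M \<sigma> - (M$1$1 * \<sigma> + M$1$2)))
      + trace (adj M ** C 0)" for M n
    by (simp add: trace_def sum_2 C_def M1_def M2_def den_def matrix_mult_nth_2 adj_def p algebra_simps)
  have hyp: "\<forall>\<^sub>F n in sequentially. 2 < \<bar>trace (adj M ** C n)\<bar>"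
    if "\<rho> * den M \<sigma> \<noteq> M$1$1 * \<sigma> + M$1$2" for M
  proof -
    obtain t where t: "t = trace (adj M ** C 0)" by blast
    show ?thesis
      unfolding tr [of M, folded t] by (rule eventually_linear_abs_gt) (use that q in simp)
  qed
  have A\<sigma>: "mob A \<sigma> < mob A x1" using r \<sigma> by (intro mob_less [OF A(1)]) auto
  have hypA: "\<rho> * den A \<sigma> \<noteq> A$1$1 * \<sigma> + A$1$2"
  proof
    assume "\<rho> * den A \<sigma> = A$1$1 * \<sigma> + A$1$2"
    then have "mob A \<sigma> = \<rho>" using denA [of \<sigma>] \<sigma> by (simp add: mob_def flip: \<open>\<rho> * den A \<sigma> = _\<close>)
    then show False using A\<sigma> r(6) \<rho>(2) by simp
  qed
  have hypB: "\<rho> * den B \<sigma> \<noteq> B$1$1 * \<sigma> + B$1$2"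
  proof
    assume eq: "\<rho> * den B \<sigma> = B$1$1 * \<sigma> + B$1$2"
    have "den B \<sigma> \<noteq> 0"
    proof
      assume 0: "den B \<sigma> = 0"
      then have 1: "B$1$1 * \<sigma> + B$1$2 = 0" using eq by simp
      have "1 = B$1$1 * B$2$2 - B$1$2 * B$2$1" using B(1) by (simp add: sl_iff)
      also have "\<dots> = B$1$1 * den B \<sigma> - B$2$1 * (B$1$1 * \<sigma> + B$1$2)" by (simp add: den_def algebra_simps)
      finally show False using 0 1 by simp
    qed
    then have 1: "mob B \<sigma> = \<rho>" "den B \<sigma> \<noteq> 0" using eq by (simp_all add: mob_def flip: eq)
    obtain z where z: "y1 \<le> z" "z \<le> y" "mob B z = \<rho>"
      using IVT' [of "mob B" y1 \<rho> y] contB \<rho> r(4) by auto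
    have "\<sigma> = z"
      using mob_adj_mob [OF B(1) 1(2)] mob_adj_mob [OF B(1) denB [OF z(1,2)]] 1(1) z(3) by simp
    then show False using z \<sigma> r by simp
  qed
  have c: "C n $2$1 = real n * (of_int q * of_int q') + C 0 $2$1" for n
    by (simp add: C_def M1_def M2_def matrix_mult_nth_2 algebra_simps)
  obtain c0 where c0: "c0 = C 0 $2$1" by blast
  have "\<forall>\<^sub>F n in sequentially. 0 < C n $2$1"
    unfolding c [folded c0] by (rule eventually_linear_gt) (use q in simp)
  moreover have "\<forall>\<^sub>F n in sequentially. 0 < den (C n) x1" "\<forall>\<^sub>F n in sequentially. mob A x1 < mob (C n) x1"
    "\<forall>\<^sub>F n in sequentially. 0 < den (C n) y1" "\<forall>\<^sub>F n in sequentially. mob B y1 < mob (C n) y1"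
    "\<forall>\<^sub>F n in sequentially. 0 < den (C n) y"
    using \<sigma> r \<rho> by (auto intro!: den_large close)
  ultimately have "\<forall>\<^sub>F n in sequentially. 0 < C n $2$1 \<and> 0 < den (C n) x1 \<and> mob A x1 < mob (C n) x1 \<and>
     0 < den (C n) y1 \<and> mob B y1 < mob (C n) y1 \<and> 0 < den (C n) y \<and>
     2 < \<bar>trace (adj A ** C n)\<bar> \<and> 2 < \<bar>trace (adj B ** C n)\<bar>"
    using hyp [OF hypA] hyp [OF hypB] by eventually_elim simp
  then obtain n where n: "0 < C n $2$1" "0 < den (C n) x1" "mob A x1 < mob (C n) x1"
     "0 < den (C n) y1" "mob B y1 < mob (C n) y1" "0 < den (C n) y"
     "2 < \<bar>trace (adj A ** C n)\<bar>" "2 < \<bar>trace (adj B ** C n)\<bar>"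
    using eventually_happens' [OF sequentially_bot] by blast
  define D where "D = C n"
  define s where "s = - D$2$2 / D$2$1"
  have den_s: "den D z = D$2$1 * (z - s)" for z
    using n(1) by (simp add: den_def s_def D_def field_simps)
  have D: "D \<in> sl \<int>" "D$2$1 > 0" using C n by (simp_all add: D_def)
  have "den D \<sigma> < 0"
  proof -
    have "of_int q' * den D \<sigma> = of_int q * (- of_int (- e' * p' - f' * q'))"
      by (simp add: D_def den \<kappa>_def \<beta>_def p algebra_simps)
    then have "of_int q' * den D \<sigma> < 0" unfolding ef' using q by simp
    then show ?thesis using q by (simp add: mult_less_0_iff)
  qed
  then have "\<sigma> < s" using D(2) by (simp add: den_s mult_less_0_iff)
  have "s < x1" using n(2) D(2) den_s [of x1] by (simp add: D_def zero_less_mult_iff)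
  \<comment> \<open>The difference of the two maps times \<open>den D\<close>, so that it extends continuously to the pole.\<close>
  define \<Delta> where "\<Delta> z = (D$1$1 * z + D$1$2) - mob A z * den D z" for z
  have "D$2$1 * \<Delta> s = - (D$1$1 * D$2$2 - D$1$2 * D$2$1)"
    using D(2) by (simp add: \<Delta>_def den_s) (simp add: s_def field_simps)
  then have "D$2$1 * \<Delta> s < 0" using D(1) by (simp add: sl_iff)
  then have \<Delta>s: "\<Delta> s < 0" using D(2) by (simp add: mult_less_0_iff)
  have \<Delta>: "\<Delta> z = (mob D z - mob A z) * den D z" if "den D z \<noteq> 0" for z
  proof -
    have "D$1$1 * z + D$1$2 = mob D z * den D z" using that by (simp add: mob_def)
    then show ?thesis by (simp add: \<Delta>_def algebra_simps)
  qed
  have \<Delta>x1: "\<Delta> x1 > 0" using n \<Delta> [of x1] by (simp add: D_def)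
  have "continuous_on {s..x1} \<Delta>"
    unfolding \<Delta>_def den_def using \<open>\<sigma> < s\<close> \<sigma> by (intro continuous_intros contA) simp
  then obtain u where u: "s \<le> u" "u \<le> x1" "\<Delta> u = 0"
    using IVT' [of \<Delta> s 0 x1] \<Delta>s \<Delta>x1 \<open>s < x1\<close> by auto
  have "u \<noteq> s" "u \<noteq> x1" using u \<Delta>s \<Delta>x1 by auto
  then have u': "s < u" "u < x1" using u by simp_all
  then have du: "den D u > 0" using D(2) by (simp add: den_s)
  have mu: "mob D u = mob A u" using \<Delta> [of u] du u(3) by simp
  have dD: "den D z > 0" if "y1 \<le> z" for z
    using D(2) \<open>s < x1\<close> r(5) that by (simp add: den_s)
  have contD: "continuous_on {y1..y} (mob D)"
    using dD by (intro continuous_at_imp_continuous_on ballI isCont_mob) force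
  have "\<beta> y / (of_int q * den D y) > 0" using q \<beta> [of y] n(6) \<sigma> r by (simp add: D_def)
  then have Dy: "mob D y < mob B y" using mob [of n y] n(6) \<rho>(3) by (simp add: D_def)
  have "continuous_on {y1..y} (\<lambda>z. mob B z - mob D z)"
    by (intro continuous_intros contB contD)
  then obtain v where v: "y1 \<le> v" "v \<le> y" "mob B v - mob D v = 0"
    using IVT' [of "\<lambda>z. mob B z - mob D z" y1 0 y] n(5) Dy r(4) by (auto simp: D_def)
  have "v \<noteq> y1" "v \<noteq> y" using v(3) n(5) Dy by (auto simp: D_def)
  then have v': "y1 < v" "v < y" using v by simp_all
  have dv: "den D v > 0" using dD v by simp
  have in_PZ: "z \<in> P_Z"
    if M: "M \<in> sl \<int>" "den M z \<noteq> 0" "2 < \<bar>trace (adj M ** C n)\<bar>" and z: "den D z > 0" "mob D z = mob M z"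
    for M z
  proof (rule P_Z_I)
    show "adj M ** D \<in> sl \<int>" using M(1) D(1) by (intro ints.sl_mult ints.sl_adj)
    show "2 < \<bar>trace (adj M ** D)\<bar>" using M(3) by (simp add: D_def)
    show "den (adj M ** D) z \<noteq> 0" using z den_adj_mob [OF M(1,2)] by (auto simp: den_mult)
    show "mob (adj M ** D) z = z" using z mob_adj_mob [OF M(1,2)] by (simp add: mob_mult)
  qed
  have "u \<in> P_Z" using in_PZ [OF A(1) _ n(7) du mu] denA [of u] u' \<open>\<sigma> < s\<close> \<sigma> by simp
  moreover have "v \<in> P_Z" using in_PZ [OF B(1) _ n(8) dv] denB [of v] v by simp
  ultimately show ?thesis
    using D du mu u' v' v(3) \<open>\<sigma> < s\<close> \<sigma> r by (intro bexI [of _ D] bexI [of _ u] bexI [of _ v]) auto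
qed

section \<open>The action on the projective line and local germs\<close>

lemma carrier_PSL2_E:
  assumes "Q \<in> carrier (PSL2 K)"
  obtains A where "A \<in> sl K" "mobius Q = mobius_mat A"
  using assms by (auto simp: carrier_PSL2 mobius_coset)

lemma carrier_PSL2_I: "A \<in> sl K \<Longrightarrow> \<exists>Q\<in>carrier (PSL2 K). mobius Q = mobius_mat A"
  by (auto simp: carrier_PSL2 intro!: bexI [of _ "{A, - A}"] mobius_coset)

lemma eventually_not_in_closed:
  assumes "closedin RP1 I" "Some x \<notin> I"
  shows "\<forall>\<^sub>F y in nhds x. Some y \<notin> I"
proof -
  have "openin RP1 (topspace RP1 - I)" using assms(1) by blast
  then have "openin euclidean {y \<in> topspace euclidean. Some y \<in> topspace RP1 - I}"
    by (rule openin_continuous_map_preimage [OF continuous_map_Some])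
  then have "open {y::real. Some y \<notin> I}" by simp
  from eventually_nhds_in_open [OF this, of x] show ?thesis using assms(2) by simp
qed

lemma eventually_not_in_closed_infinity:
  assumes "closedin RP1 I" "None \<notin> I"
  shows "\<forall>\<^sub>F y in at_top. Some y \<notin> I" "\<forall>\<^sub>F y in at_bot. Some y \<notin> I"
proof -
  obtain C :: "real set" where C: "compact C" "I = Some ` C"
    using assms by (auto simp: closedin_Alexandroff_compactification)
  obtain B where B: "\<And>y. y \<in> C \<Longrightarrow> \<bar>y\<bar> \<le> B"
    using compact_imp_bounded [OF C(1)] by (auto simp: bounded_iff)
  have "Some y \<notin> I" if "\<bar>y\<bar> > B" for y using B that by (force simp: C(2))
  then have out: "Some y \<notin> I" if "\<bar>B\<bar> < y \<or> y < - \<bar>B\<bar>" for y using that by auto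
  show "\<forall>\<^sub>F y in at_top. Some y \<notin> I"
    by (rule eventually_mono [OF eventually_gt_at_top [of "\<bar>B\<bar>"]]) (use out in simp)
  show "\<forall>\<^sub>F y in at_bot. Some y \<notin> I"
    by (rule eventually_mono [OF eventually_gt_at_bot [of "- \<bar>B\<bar>"]]) (use out in simp)
qed

text \<open>On the circle, two points \<open>a\<close>, \<open>b\<close> outside a connected set confine it to one of the two arcs.\<close>

lemma connectedin_RP1_between:
  assumes I: "connectedin RP1 I" and out: "Some a \<notin> I" "Some b \<notin> I"
    and y: "Some y \<in> I" "a < y" "y < b" and p: "p \<in> I"
  shows "p \<in> Some ` {a<..<b}"
proof (rule ccontr)
  assume p': "p \<notin> Some ` {a<..<b}"
  define U where "U = Some ` {a<..<b}"
  define V where "V = insert None (Some ` (UNIV - {a..b}))"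
  have "openin RP1 U" by (simp add: U_def)
  moreover have "openin RP1 V"
    unfolding openin_Alexandroff_compactification V_def by (intro disjI2 exI [of _ "{a..b}"]) auto
  moreover have I_UV: "I \<subseteq> U \<union> V"
  proof
    fix q assume q: "q \<in> I"
    show "q \<in> U \<union> V"
    proof (cases q)
      case (Some t)
      then have "t \<noteq> a" "t \<noteq> b" using q out by auto
      then show ?thesis using Some by (auto simp: U_def V_def)
    qed (simp add: V_def)
  qed
  moreover have "U \<inter> V = {}" by (auto simp: U_def V_def)
  moreover have "Some y \<in> U" using y by (simp add: U_def)
  moreover have "p \<notin> U" using p' by (simp add: U_def)
  ultimately show False using I y(1) p unfolding connectedin by blast
qed

text \<open>The four ways in which real points tend to a point of the projective line from one side.\<close>

definition approaches :: "real filter \<Rightarrow> real option \<Rightarrow> bool" where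
  "approaches F p \<longleftrightarrow> (case p of None \<Rightarrow> F = at_top \<or> F = at_bot | Some x \<Rightarrow> F = at_left x \<or> F = at_right x)"

lemma approaches_cases:
  assumes "approaches F p"
  obtains x where "p = Some x" "F = at_right x" | x where "p = Some x" "F = at_left x"
    | "p = None" "F = at_top" | "p = None" "F = at_bot"
  using assms by (auto simp: approaches_def split: option.splits)

text \<open>If an interval contained points arbitrarily close to \<open>p\<close> on one side and also missed such points, then
  it would contain a point between two missing ones, contradicting that it also contains \<open>p\<close>.\<close>

lemma closed_interval_near:
  assumes I: "closed_interval_RP1 I" and F: "approaches F p"
  shows "p \<in> I \<and> (\<forall>\<^sub>F y in F. Some y \<in> I) \<or> (\<forall>\<^sub>F y in F. Some y \<notin> I)"
proof (cases "p \<in> I")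
  case False
  have cl: "closedin RP1 I" using I by (simp add: closed_interval_RP1_def)
  from F have "\<forall>\<^sub>F y in F. Some y \<notin> I"
  proof (cases rule: approaches_cases)
    case (1 x)
    then show ?thesis
      using filter_leD [OF at_side_le_nhds(2) eventually_not_in_closed [OF cl]] False by blast
  next
    case (2 x)
    then show ?thesis
      using filter_leD [OF at_side_le_nhds(1) eventually_not_in_closed [OF cl]] False by blast
  qed (use eventually_not_in_closed_infinity [OF cl] False in auto)
  then show ?thesis ..
next
  case True
  have con: "connectedin RP1 I" using I by (simp add: closed_interval_RP1_def)
  have in_if: "(\<forall>\<^sub>F y in F. Some y \<in> I)" if freq: "\<exists>\<^sub>F y in F. Some y \<in> I"
  proof (rule ccontr)
    assume "\<not> (\<forall>\<^sub>F y in F. Some y \<in> I)"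
    then have out: "\<exists>\<^sub>F y in F. Some y \<notin> I" by (simp add: not_eventually)
    \<comment> \<open>Between two points outside there is a point inside, but \<open>p\<close> is not between them.\<close>
    obtain a y b where "a < y" "y < b" "Some a \<notin> I" "Some y \<in> I" "Some b \<notin> I" "p \<notin> Some ` {a<..<b}"
      using F
    proof (cases rule: approaches_cases)
      case (1 x)
      have fr: "\<exists>y. x < y \<and> y < b \<and> Q y" if "x < b" "\<exists>\<^sub>F y in F. Q y" for b Q
        using that unfolding 1(2) frequently_def eventually_at_right_field by blast
      obtain b where b: "x < b" "Some b \<notin> I" using fr [OF _ out, of "x + 1"] by auto
      obtain y where y: "x < y" "y < b" "Some y \<in> I" using fr [OF b(1) freq] by auto
      obtain a where a: "x < a" "a < y" "Some a \<notin> I" using fr [OF y(1) out] by auto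
      show ?thesis by (rule that [of a y b]) (use a y b 1 in auto)
    next
      case (2 x)
      have fr: "\<exists>y. b < y \<and> y < x \<and> Q y" if "b < x" "\<exists>\<^sub>F y in F. Q y" for b Q
        using that unfolding 2(2) frequently_def eventually_at_left_field by blast
      obtain a where a: "a < x" "Some a \<notin> I" using fr [OF _ out, of "x - 1"] by auto
      obtain y where y: "a < y" "y < x" "Some y \<in> I" using fr [OF a(1) freq] by auto
      obtain b where b: "y < b" "b < x" "Some b \<notin> I" using fr [OF y(2) out] by auto
      show ?thesis by (rule that [of a y b]) (use a y b 2 in auto)
    next
      case 3
      have fr: "\<exists>y. b < y \<and> Q y" if "\<exists>\<^sub>F y in F. Q y" for b Q
        using that unfolding 3(2) frequently_def eventually_at_top_dense by blast
      obtain a where a: "Some a \<notin> I" using fr [OF out] by blast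
      obtain y where y: "a < y" "Some y \<in> I" using fr [OF freq] by blast
      obtain b where b: "y < b" "Some b \<notin> I" using fr [OF out] by blast
      show ?thesis by (rule that [of a y b]) (use a y b 3 in auto)
    next
      case 4
      have fr: "\<exists>y. y < b \<and> Q y" if "\<exists>\<^sub>F y in F. Q y" for b Q
        using that unfolding 4(2) frequently_def eventually_at_bot_dense by blast
      obtain b where b: "Some b \<notin> I" using fr [OF out] by blast
      obtain y where y: "y < b" "Some y \<in> I" using fr [OF freq] by blast
      obtain a where a: "a < y" "Some a \<notin> I" using fr [OF out] by blast
      show ?thesis by (rule that [of a y b]) (use a y b 4 in auto)
    qed
    then show False using connectedin_RP1_between [OF con] True by blast
  qed
  show ?thesis
  proof (cases "\<exists>\<^sub>F y in F. Some y \<in> I")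
    case False
    then show ?thesis unfolding not_frequently by (rule disjI2)
  qed (simp add: in_if True)
qed

text \<open>Among finitely many closed intervals covering the line, one contains all points close to \<open>p\<close> on the
  given side.\<close>

lemma piecewise_mobius_germ:
  assumes f: "piecewise_mobius (carrier (PSL2 K)) f" and F: "approaches F p"
  obtains A where "A \<in> sl K" "f p = mobius_mat A p" "\<forall>\<^sub>F y in F. f (Some y) = mobius_mat A (Some y)"
proof -
  obtain \<I> where \<I>: "finite \<I>" "\<And>I. I \<in> \<I> \<Longrightarrow> closed_interval_RP1 I" "\<Union>\<I> = topspace RP1"
    "\<And>I. I \<in> \<I> \<Longrightarrow> \<exists>Q\<in>carrier (PSL2 K). \<forall>p\<in>I. f p = mobius Q p"
    using f unfolding piecewise_mobius_def by metis
  have "F \<noteq> bot" using F by (cases rule: approaches_cases) auto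
  have "\<exists>I\<in>\<I>. p \<in> I \<and> (\<forall>\<^sub>F y in F. Some y \<in> I)"
  proof (rule ccontr)
    assume "\<not> ?thesis"
    then have "\<forall>I\<in>\<I>. \<forall>\<^sub>F y in F. Some y \<notin> I"
      using closed_interval_near [OF \<I>(2) F] by blast
    then have "\<forall>\<^sub>F y in F. \<forall>I\<in>\<I>. Some y \<notin> I"
      using \<I>(1) by (simp add: eventually_ball_finite)
    from eventually_happens' [OF \<open>F \<noteq> bot\<close> this] obtain y where "\<forall>I\<in>\<I>. Some y \<notin> I" ..
    moreover have "Some y \<in> \<Union>\<I>" unfolding \<I>(3) by simp
    ultimately show False by blast
  qed
  then obtain I where I: "I \<in> \<I>" "p \<in> I" "\<forall>\<^sub>F y in F. Some y \<in> I" by blast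
  obtain Q where Q: "Q \<in> carrier (PSL2 K)" "\<forall>p\<in>I. f p = mobius Q p" using \<I>(4) [OF I(1)] by blast
  obtain A where A: "A \<in> sl K" "mobius Q = mobius_mat A" using carrier_PSL2_E [OF Q(1)] by blast
  have "\<forall>\<^sub>F y in F. f (Some y) = mobius_mat A (Some y)"
    using I(3) by eventually_elim (use Q A in auto)
  then show ?thesis using that A Q I(2) by auto
qed

lemma locally_increasing_imp_strict_mono:
  fixes h :: "real \<Rightarrow> real"
  assumes right: "\<And>x. \<forall>\<^sub>F y in at_right x. h x < h y" and left: "\<And>x. \<forall>\<^sub>F y in at_left x. h y < h x"
  shows "strict_mono h"
proof (rule strict_monoI)
  fix a b :: real assume "a < b"
  then have "a \<le> b" by simp
  then have "a < b \<longrightarrow> h a < h b"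
  proof (induction rule: Bolzano)
    case (trans a b c)
    then show ?case by (cases "a = b"; cases "b = c") auto
  next
    case (local x)
    obtain r where r: "r > x" "\<And>y. x < y \<Longrightarrow> y < r \<Longrightarrow> h x < h y"
      using right [of x] by (auto simp: eventually_at_right_field)
    obtain l where l: "l < x" "\<And>y. l < y \<Longrightarrow> y < x \<Longrightarrow> h y < h x"
      using left [of x] by (auto simp: eventually_at_left_field)
    have "h a < h b" if "a \<le> x" "x \<le> b" "b - a < min (r - x) (x - l)" "a < b" for a b
      using that r(2) [of b] l(2) [of a] by (cases "a = x"; cases "b = x") auto
    then show ?case using r(1) l(1) by (intro exI [of _ "min (r - x) (x - l)"]) auto
  qed
  then show "h a < h b" using \<open>a < b\<close> by simp
qed

lemma germ_strict:
  assumes "germ K (at_right x) x h" shows "\<forall>\<^sub>F y in at_right x. h x < h y"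
proof -
  obtain A where A: "A \<in> sl K" "den A x \<noteq> 0" "h x = mob A x" "\<forall>\<^sub>F y in at_right x. h y = mob A y"
    using assms by (auto simp: germ_def)
  have "\<forall>\<^sub>F y in at_right x. den A y * den A x > 0"
    using eventually_den [OF A(2)] by (rule filter_leD [rotated]) (rule at_side_le_nhds)
  moreover have "\<forall>\<^sub>F y in at_right x. x < y" by (simp add: eventually_at_right_less)
  ultimately show ?thesis using A(4)
    by eventually_elim (use A mob_less in \<open>auto simp: mult.commute\<close>)
qed

lemma germ_strict_left:
  assumes "germ K (at_left x) x h" shows "\<forall>\<^sub>F y in at_left x. h y < h x"
proof -
  obtain A where A: "A \<in> sl K" "den A x \<noteq> 0" "h x = mob A x" "\<forall>\<^sub>F y in at_left x. h y = mob A y"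
    using assms by (auto simp: germ_def)
  have "\<forall>\<^sub>F y in at_left x. den A y * den A x > 0"
    using eventually_den [OF A(2)] by (rule filter_leD [rotated]) (rule at_side_le_nhds)
  moreover have "\<forall>\<^sub>F y in at_left x. y < x" by (simp add: eventually_at_filter)
  ultimately show ?thesis using A(4)
    by eventually_elim (use A mob_less in \<open>auto simp: mult.commute\<close>)
qed

text \<open>Two Moebius maps that agree to the right of \<open>x\<close> agree wherever both are finite, as their
  difference has a numerator of degree at most two. Hence a breakpoint, which is defined through matrices over the reals, can be
  recognised by matrices over any subring.\<close>

lemma mob_eq_near:
  assumes A: "den A x \<noteq> 0" and B: "den B x \<noteq> 0"
    and eq: "\<forall>\<^sub>F y in at_right x. mob A y = mob B y"
  shows "\<forall>\<^sub>F y in nhds x. mob A y = mob B y"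
proof -
  define c2 c1 c0 where "c2 = A$1$1 * B$2$1 - B$1$1 * A$2$1"
    and "c1 = A$1$1 * B$2$2 + A$1$2 * B$2$1 - B$1$1 * A$2$2 - B$1$2 * A$2$1"
    and "c0 = A$1$2 * B$2$2 - B$1$2 * A$2$2"
  have poly: "(A$1$1 * y + A$1$2) * den B y - (B$1$1 * y + B$1$2) * den A y = c0 + c1 * y + c2 * y\<^sup>2" for y
    by (simp add: c0_def c1_def c2_def den_def power2_eq_square algebra_simps)
  have iff: "mob A y = mob B y \<longleftrightarrow> c0 + c1 * y + c2 * y\<^sup>2 = 0" if "den A y \<noteq> 0" "den B y \<noteq> 0" for y
    using that poly [of y] by (auto simp: mob_def frac_eq_eq)
  have nz: "\<forall>\<^sub>F y in nhds x. den A y \<noteq> 0" "\<forall>\<^sub>F y in nhds x. den B y \<noteq> 0"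
    using A B by (auto intro: eventually_den_nonzero)
  have le: "at_right x \<le> nhds x" by (simp add: at_within_def)
  have "\<forall>\<^sub>F y in at_right x. c0 + c1 * y + c2 * y\<^sup>2 = 0"
    using filter_leD [OF le nz(1)] filter_leD [OF le nz(2)] eq by eventually_elim (simp add: iff)
  then obtain r where r: "r > x" "\<And>y. x < y \<Longrightarrow> y < r \<Longrightarrow> c0 + c1 * y + c2 * y\<^sup>2 = 0"
    by (auto simp: eventually_at_right_field)
  define d where "d = (r - x) / 4"
  have "4 * d = r - x" by (simp add: d_def)
  with r(1) have d: "d > 0" "x + 3 * d < r" by linarith+
  have z: "c0 + c1 * (x + i * d) + c2 * (x + i * d)\<^sup>2 = 0" if "0 < i" "i \<le> 3" for i
  proof (rule r(2))
    show "x < x + i * d" using that d by simp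
    have "i * d \<le> 3 * d" using that d by (intro mult_right_mono) auto
    then show "x + i * d < r" using d by linarith
  qed
  have "2 * c2 * d\<^sup>2 = (c0 + c1 * (x + 3 * d) + c2 * (x + 3 * d)\<^sup>2)
      - 2 * (c0 + c1 * (x + 2 * d) + c2 * (x + 2 * d)\<^sup>2) + (c0 + c1 * (x + 1 * d) + c2 * (x + 1 * d)\<^sup>2)"
    by (simp add: power2_eq_square algebra_simps)
  also have "\<dots> = 0" using z [of 1] z [of 2] z [of 3] by simp
  finally have "2 * c2 * d\<^sup>2 = 0" .
  then have c2: "c2 = 0" using d by simp
  have "c1 * d = (c0 + c1 * (x + 2 * d)) - (c0 + c1 * (x + 1 * d))"
    by (simp add: algebra_simps)
  also have "\<dots> = 0" using z [of 1] z [of 2] by (simp add: c2)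
  finally have "c1 * d = 0" .
  then have c1: "c1 = 0" using d by simp
  have "c0 = 0" using z [of 1] by (simp add: c1 c2)
  with c1 c2 have "c0 + c1 * y + c2 * y\<^sup>2 = 0" for y by simp
  with nz show ?thesis by (auto simp: iff elim: eventually_elim2)
qed


text \<open>Each germ is increasing because determinants are positive, and a function that increases through
  each point is increasing; so these homeomorphisms preserve orientation.\<close>

lemma (in subring_of_reals) piecewise_homeo_in_PW:
  assumes h: "h \<in> piecewise_homeos (carrier (PSL2 K))" and breaks: "\<And>x. breakpoint h x \<Longrightarrow> x \<in> P"
  shows "h \<in> PW K P"
proof -
  obtain f where f: "homeomorphic_map RP1 RP1 f" "piecewise_mobius (carrier (PSL2 K)) f"
    "f None = None" "\<And>x. f (Some x) = Some (h x)"
    using h by (auto simp: piecewise_homeos_def)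
  have germ: "germ K F x h" if F: "approaches F (Some x)" for F x
  proof -
    obtain A where A: "A \<in> sl K" "f (Some x) = mobius_mat A (Some x)"
      "\<forall>\<^sub>F y in F. f (Some y) = mobius_mat A (Some y)"
      by (rule piecewise_mobius_germ [OF f(2) F])
    have "\<forall>\<^sub>F y in F. h y = mob A y"
      using A(3) by eventually_elim (auto simp: f(4) mob_Some split: if_splits)
    then show ?thesis using A(1,2) unfolding germ_def by (auto simp: f(4) mob_Some split: if_splits)
  qed
  have left: "germ K (at_left x) x h" and right: "germ K (at_right x) x h" for x
    by (auto intro: germ simp: approaches_def)
  have affine: "affine_at K F h" if F: "approaches F None" for F
  proof -
    obtain A where A: "A \<in> sl K" "f None = mobius_mat A None"
      "\<forall>\<^sub>F y in F. f (Some y) = mobius_mat A (Some y)"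
      by (rule piecewise_mobius_germ [OF f(2) F])
    have c: "A$2$1 = 0" using A(2) by (auto simp: f(3) mobius_mat_def split: if_splits)
    then have ad: "A$1$1 * A$2$2 = 1" and K: "A$1$1 \<in> K" "A$1$2 \<in> K" "A$2$2 \<in> K"
      using A(1) by (auto simp: sl_iff)
    have inv: "inverse (A$1$1) = A$2$2" using ad by (rule inverse_unique)
    have "mob A y = (A$1$1)\<^sup>2 * y + A$1$1 * A$1$2" for y
    proof -
      have "mob A y = (A$1$1 * y + A$1$2) / A$2$2" by (simp add: mob_def den_def c)
      also have "\<dots> = (A$1$1 * y + A$1$2) * A$1$1"
        using ad by (simp flip: inv add: divide_inverse)
      finally show ?thesis by (simp add: power2_eq_square algebra_simps)
    qed
    then have "\<forall>\<^sub>F y in F. h y = (A$1$1)\<^sup>2 * y + A$1$1 * A$1$2"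
      using A(3) by (auto elim!: eventually_mono simp: f(4) mob_Some split: if_splits)
    moreover have "(A$1$1)\<^sup>2 \<in> sq_units K"
      using K ad unfolding sq_units_def by (auto simp: inv intro!: exI [of _ "A$1$1"])
    ultimately show ?thesis using K_mult [OF K(1,2)] unfolding affine_at_def by blast
  qed
  have "strict_mono h"
    using germ_strict [OF right] germ_strict_left [OF left] by (rule locally_increasing_imp_strict_mono)
  moreover have "surj h"
    unfolding surj_def
  proof
    fix y
    have "Some y \<in> f ` topspace RP1"
      using homeomorphic_imp_surjective_map [OF f(1)] by simp
    then obtain p where "f p = Some y" by auto
    then show "\<exists>x. y = h x" using f(3,4) by (cases p) auto
  qed
  moreover have "germ K (nhds x) x h" if "x \<notin> P" for x
  proof -
    have "\<not> breakpoint h x" using breaks that by blast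
    then obtain U Q where U: "open U" "x \<in> U" "Q \<in> carrier (PSL2 \<real>)" "\<And>y. y \<in> U \<Longrightarrow> Some (h y) = mobius Q (Some y)"
      unfolding breakpoint_def by blast
    obtain B where B: "mobius Q = mobius_mat B" using carrier_PSL2_E [OF U(3)] by blast
    obtain A where A: "A \<in> sl K" "den A x \<noteq> 0" "h x = mob A x" "\<forall>\<^sub>F y in at_right x. h y = mob A y"
      using right [of x] by (auto simp: germ_def)
    have hB: "den B y \<noteq> 0 \<and> h y = mob B y" if "y \<in> U" for y
      using U(4) [OF that] by (auto simp: B mob_Some split: if_splits)
    have U': "\<forall>\<^sub>F y in nhds x. y \<in> U" using U by (simp add: eventually_nhds_in_open)
    have "\<forall>\<^sub>F y in at_right x. mob A y = mob B y"
      using A(4) filter_leD [OF at_side_le_nhds(2) U'] by eventually_elim (use hB in simp)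
    then have "\<forall>\<^sub>F y in nhds x. mob A y = mob B y"
      using mob_eq_near A(2) hB [OF U(2)] by blast
    with U' have "\<forall>\<^sub>F y in nhds x. h y = mob A y" by eventually_elim (use hB in simp)
    then show ?thesis using A unfolding germ_def by blast
  qed
  ultimately show ?thesis
    using left right affine by (simp add: PW_def approaches_def)
qed

lemma closed_interval_Some: "closed_interval_RP1 (Some ` {a..b})"
proof -
  have "connectedin RP1 (Some ` {a..b})"
    by (rule connectedin_continuous_map_image [OF continuous_map_Some]) simp
  then show ?thesis by (simp add: closed_interval_RP1_def)
qed

lemma closed_interval_infinity:
  fixes S :: "real set"
  assumes S: "connected S" "closed S" "\<not> bounded S"
  shows "closed_interval_RP1 (insert None (Some ` S))"
proof -
  have "connectedin RP1 (insert None (Some ` S))"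
  proof (rule connectedin_intermediate_closure_of)
    show "connectedin RP1 (Some ` S)"
      by (rule connectedin_continuous_map_image [OF continuous_map_Some]) (simp add: S)
    have "None \<in> RP1 closure_of (Some ` S)"
      unfolding in_closure_of
    proof (intro conjI allI impI)
      fix T assume T: "None \<in> T \<and> openin RP1 T"
      then obtain C :: "real set" where C: "compact C" "T = insert None (Some ` (UNIV - C))"
        by (auto simp: openin_Alexandroff_compactification)
      have "\<not> S \<subseteq> C" using S(3) compact_imp_bounded [OF C(1)] bounded_subset by blast
      then show "\<exists>y. y \<in> Some ` S \<and> y \<in> T" using C(2) by auto
    qed simp
    then show "insert None (Some ` S) \<subseteq> RP1 closure_of (Some ` S)"
      by (auto intro: closure_of_subset [THEN subsetD])
  qed auto
  moreover have "closedin RP1 (insert None (Some ` S))"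
    unfolding closedin_Alexandroff_compactification
    using S(2) by (intro disjI2 exI [of _ "- S"]) auto
  ultimately show ?thesis by (simp add: closed_interval_RP1_def)
qed

lemma unbounded_rays: "\<not> bounded {M::real..}" "\<not> bounded {..M::real}"
proof -
  have "\<not> (\<forall>x\<in>{M..}. \<bar>x\<bar> \<le> B)" for B
    by (auto intro!: bexI [of _ "\<bar>M\<bar> + \<bar>B\<bar> + 1"])
  then show "\<not> bounded {M..}" by (simp add: bounded_iff)
  have "\<not> (\<forall>x\<in>{..M}. \<bar>x\<bar> \<le> B)" for B
    by (auto intro!: bexI [of _ "- \<bar>M\<bar> - \<bar>B\<bar> - 1"])
  then show "\<not> bounded {..M}" by (simp add: bounded_iff)
qed

lemma continuous_map_option:
  assumes "strict_mono h" "surj h"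
  shows "continuous_map RP1 RP1 (map_option h)"
  unfolding continuous_map
proof (intro conjI allI impI)
  note i = strict_mono_inv [OF assms]
  have cont: "continuous_on UNIV h" "continuous_on UNIV (finv h)"
    using continuous_strict_mono_surj [OF assms] continuous_strict_mono_surj [OF i]
    by (simp_all add: continuous_at_imp_continuous_on)
  have inj: "inj h" using assms(1) by (rule strict_mono_imp_inj_on)
  have "map_option h p \<in> insert None (range Some)" for p by (cases p) auto
  then show "map_option h ` topspace RP1 \<subseteq> topspace RP1" by auto
  fix U assume "openin RP1 U"
  then consider V where "open V" "U = Some ` V"
    | C where "compact C" "U = insert None (Some ` (UNIV - C))"
    by (auto simp: openin_Alexandroff_compactification)
  then show "openin RP1 {p \<in> topspace RP1. map_option h p \<in> U}"
  proof cases
    case (1 V)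
    have "{p \<in> topspace RP1. map_option h p \<in> U} = Some ` (h -` V)"
      using 1(2) by (auto simp: image_iff)
    moreover have "open (h -` V)" using 1(1) cont(1) by (rule open_vimage)
    ultimately show ?thesis by simp
  next
    case (2 C)
    have "{p \<in> topspace RP1. map_option h p \<in> U} = insert None (Some ` (UNIV - finv h ` C))"
    proof -
      have "h t \<in> C \<longleftrightarrow> t \<in> finv h ` C" for t
        using inv_f_f [OF inj] surj_f_inv_f [OF assms(2)] by (metis image_iff)
      then show ?thesis using 2(2) by auto
    qed
    moreover have "compact (finv h ` C)"
      using cont(2) 2(1) by (intro compact_continuous_image) (auto intro: continuous_on_subset)
    ultimately show ?thesis
      unfolding openin_Alexandroff_compactification by (intro disjI2 exI [of _ "finv h ` C"]) (auto simp: compact_imp_closed)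
  qed
qed

lemma homeomorphic_map_option:
  assumes "strict_mono h" "surj h"
  shows "homeomorphic_map RP1 RP1 (map_option h)"
proof -
  have "inj h" using assms(1) by (rule strict_mono_imp_inj_on)
  then have "finv h (h x) = x" "h (finv h x) = x" for x
    using assms(2) by (simp_all add: surj_f_inv_f)
  then have "map_option (finv h) (map_option h p) = p" "map_option h (map_option (finv h) p) = p" for p
    by (cases p; simp)+
  then have "homeomorphic_maps RP1 RP1 (map_option h) (map_option (finv h))"
    using continuous_map_option [OF assms] continuous_map_option [OF strict_mono_inv [OF assms]]
    by (simp add: homeomorphic_maps_def)
  then show ?thesis by (rule homeomorphic_maps_imp_map)
qed

text \<open>Compactness of the projective line.\<close>

lemma piecewise_mobius_local:
  assumes local: "\<And>p. \<exists>U \<I>. openin RP1 U \<and> p \<in> U \<and> U \<subseteq> \<Union>\<I> \<and> finite \<I> \<and>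
      (\<forall>I\<in>\<I>. closed_interval_RP1 I \<and> (\<exists>Q\<in>K. \<forall>p\<in>I. f p = mobius Q p))"
  shows "piecewise_mobius K f"
proof -
  let ?good = "\<lambda>I. closed_interval_RP1 I \<and> (\<exists>Q\<in>K. \<forall>p\<in>I. f p = mobius Q p)"
  obtain U \<I> where UI: "\<And>p. openin RP1 (U p)" "\<And>p. p \<in> U p" "\<And>p. U p \<subseteq> \<Union>(\<I> p)"
    "\<And>p. finite (\<I> p)" "\<And>p I. I \<in> \<I> p \<Longrightarrow> ?good I"
    using local by metis
  have "compactin RP1 (topspace RP1)"
    using compact_space_Alexandroff_compactification by (simp only: compact_space_def)
  moreover have "\<forall>V\<in>range U. openin RP1 V" using UI(1) by auto
  moreover have "topspace RP1 \<subseteq> \<Union>(range U)" using UI(2) by blast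
  ultimately obtain \<F> where F: "finite \<F>" "\<F> \<subseteq> range U" "topspace RP1 \<subseteq> \<Union>\<F>"
    unfolding compactin_def by metis
  obtain S where S: "finite S" "\<F> = U ` S" using F(1,2) by (meson finite_subset_image)
  define \<J> where "\<J> = (\<Union>p\<in>S. \<I> p)"
  have fin: "finite \<J>" using S(1) UI(4) by (simp add: \<J>_def)
  have good: "?good I" if I: "I \<in> \<J>" for I
  proof -
    from I obtain p where "I \<in> \<I> p" unfolding \<J>_def by blast
    then show ?thesis by (rule UI(5))
  qed
  have "\<Union>\<F> \<subseteq> \<Union>\<J>"
  proof
    fix q assume "q \<in> \<Union>\<F>"
    then obtain p where "p \<in> S" "q \<in> U p" unfolding S(2) by blast
    then show "q \<in> \<Union>\<J>" using UI(3) [of p] unfolding \<J>_def by blast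
  qed
  with F(3) have "topspace RP1 \<subseteq> \<Union>\<J>" by (rule subset_trans)
  moreover have "\<Union>\<J> \<subseteq> topspace RP1"
    using good closedin_subset unfolding closed_interval_RP1_def by blast
  ultimately have "\<Union>\<J> = topspace RP1" by (rule subset_antisym [rotated])
  then show ?thesis unfolding piecewise_mobius_def using fin good
    by (intro exI [of _ \<J>] conjI ballI) simp_all
qed

lemma (in subring_of_reals) affine_is_mobius:
  assumes "s \<in> sq_units K" "b \<in> K"
  obtains A where "A \<in> sl K" "mobius_mat A None = None" "\<And>y. mobius_mat A (Some y) = Some (s * y + b)"
proof -
  obtain a where a: "s = a\<^sup>2" "a \<in> K" "inverse a \<in> K" "a \<noteq> 0"
    using assms(1) by (auto simp: sq_units_def)
  define A where "A = matrix_2x2 a (b * inverse a) 0 (inverse a)"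
  show ?thesis
  proof (rule that [of A])
    show "A \<in> sl K" using a assms(2) by (simp add: A_def sl_iff K_mult)
    show "mobius_mat A None = None" by (simp add: A_def mobius_mat_def)
    fix y
    have "(a * y + b * inverse a) / inverse a = a * a * y + b * (inverse a * a)"
      by (simp add: divide_inverse algebra_simps)
    then show "mobius_mat A (Some y) = Some (s * y + b)"
      using a(4) by (simp add: A_def mobius_mat_def a(1) power2_eq_square)
  qed
qed

lemma (in subring_of_reals) PW_piecewise_homeo:
  assumes h: "h \<in> PW K P"
  shows "h \<in> piecewise_homeos (carrier (PSL2 K))" and "breakpoint h x \<Longrightarrow> x \<in> P"
proof -
  have PW: "strict_mono h" "surj h" "\<And>x. germ K (at_left x) x h" "\<And>x. germ K (at_right x) x h"
    "\<And>x. x \<notin> P \<Longrightarrow> germ K (nhds x) x h" "affine_at K at_top h" "affine_at K at_bot h"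
    using h by (auto simp: PW_def)
  let ?f = "map_option h"
  let ?good = "\<lambda>I. closed_interval_RP1 I \<and> (\<exists>Q\<in>carrier (PSL2 K). \<forall>p\<in>I. ?f p = mobius Q p)"
  have good: "?good I" if "closed_interval_RP1 I" "A \<in> sl K" "\<And>p. p \<in> I \<Longrightarrow> ?f p = mobius_mat A p" for A I
  proof -
    obtain Q where "Q \<in> carrier (PSL2 K)" "mobius Q = mobius_mat A"
      using carrier_PSL2_I [OF \<open>A \<in> sl K\<close>] by blast
    then show ?thesis using that(1,3) by (intro conjI bexI [of _ Q] ballI) simp_all
  qed
  have "\<exists>U \<I>. openin RP1 U \<and> p \<in> U \<and> U \<subseteq> \<Union>\<I> \<and> finite \<I> \<and> (\<forall>I\<in>\<I>. ?good I)" for p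
  proof (cases p)
    case (Some x)
    obtain A where A: "A \<in> sl K" "den A x \<noteq> 0" "h x = mob A x" "\<forall>\<^sub>F y in at_left x. h y = mob A y"
      using PW(3) [of x] by (auto simp: germ_def)
    obtain B where B: "B \<in> sl K" "den B x \<noteq> 0" "h x = mob B x" "\<forall>\<^sub>F y in at_right x. h y = mob B y"
      using PW(4) [of x] by (auto simp: germ_def)
    have "\<forall>\<^sub>F y in at_left x. h y = mob A y \<and> den A y \<noteq> 0"
      using A(4) eventually_den_nonzero [OF A(2) at_side_le_nhds(1)] by eventually_elim simp
    then obtain l where l: "l < x" "\<And>y. l < y \<Longrightarrow> y < x \<Longrightarrow> h y = mob A y \<and> den A y \<noteq> 0"
      by (auto simp: eventually_at_left_field)
    have "\<forall>\<^sub>F y in at_right x. h y = mob B y \<and> den B y \<noteq> 0"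
      using B(4) eventually_den_nonzero [OF B(2) at_side_le_nhds(2)] by eventually_elim simp
    then obtain r where r: "x < r" "\<And>y. x < y \<Longrightarrow> y < r \<Longrightarrow> h y = mob B y \<and> den B y \<noteq> 0"
      by (auto simp: eventually_at_right_field)
    define l' r' where "l' = (l + x) / 2" and "r' = (x + r) / 2"
    have lr: "l < l'" "l' < x" "x < r'" "r' < r" using l(1) r(1) by (auto simp: l'_def r'_def)
    have hA: "h y = mob A y \<and> den A y \<noteq> 0" if "y \<in> {l'..x}" for y
      using l(2) [of y] A(2,3) that lr by (cases "y = x") auto
    have hB: "h y = mob B y \<and> den B y \<noteq> 0" if "y \<in> {x..r'}" for y
      using r(2) [of y] B(2,3) that lr by (cases "y = x") auto
    have "?good (Some ` {l'..x})"
      by (rule good [OF closed_interval_Some A(1)]) (use hA in \<open>auto simp: mob_Some\<close>)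
    moreover have "?good (Some ` {x..r'})"
      by (rule good [OF closed_interval_Some B(1)]) (use hB in \<open>auto simp: mob_Some\<close>)
    moreover have "openin RP1 (Some ` {l'<..<r'})" by simp
    moreover have "p \<in> Some ` {l'<..<r'}" using Some lr by simp
    moreover have "Some ` {l'<..<r'} \<subseteq> \<Union>{Some ` {l'..x}, Some ` {x..r'}}" by force
    ultimately show ?thesis
      by (intro exI [of _ "Some ` {l'<..<r'}"] exI [of _ "{Some ` {l'..x}, Some ` {x..r'}}"]) blast
  next
    case None
    obtain s b M where top: "s \<in> sq_units K" "b \<in> K" "\<And>y. y \<ge> M \<Longrightarrow> h y = s * y + b"
      using PW(6) by (auto simp: affine_at_def eventually_at_top_linorder)
    obtain s' b' M' where bot: "s' \<in> sq_units K" "b' \<in> K" "\<And>y. y \<le> M' \<Longrightarrow> h y = s' * y + b'"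
      using PW(7) by (auto simp: affine_at_def eventually_at_bot_linorder)
    obtain A where A: "A \<in> sl K" "mobius_mat A None = None" "\<And>y. mobius_mat A (Some y) = Some (s * y + b)"
      using affine_is_mobius [OF top(1,2)] by blast
    obtain B where B: "B \<in> sl K" "mobius_mat B None = None" "\<And>y. mobius_mat B (Some y) = Some (s' * y + b')"
      using affine_is_mobius [OF bot(1,2)] by blast
    let ?I = "insert None (Some ` {M..})" and ?J = "insert None (Some ` {..M'})"
    let ?U = "insert None (Some ` (UNIV - {M'..M}))"
    have "?good ?I"
      by (rule good [OF closed_interval_infinity A(1)])
        (use top(3) A(2,3) in \<open>auto simp: unbounded_rays\<close>)
    moreover have "?good ?J"
      by (rule good [OF closed_interval_infinity B(1)])
        (use bot(3) B(2,3) in \<open>auto simp: unbounded_rays\<close>)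
    moreover have "openin RP1 ?U"
      unfolding openin_Alexandroff_compactification by (intro disjI2 exI [of _ "{M'..M}"]) auto
    moreover have "p \<in> ?U" using None by simp
    moreover have "?U \<subseteq> \<Union>{?I, ?J}" by force
    ultimately show ?thesis
      by (intro exI [of _ "?U"] exI [of _ "{?I, ?J}"]) blast
  qed
  then have "piecewise_mobius (carrier (PSL2 K)) ?f" by (rule piecewise_mobius_local)
  then show "h \<in> piecewise_homeos (carrier (PSL2 K))"
    unfolding piecewise_homeos_def
    using homeomorphic_map_option [OF PW(1,2)] by (intro CollectI exI [of _ ?f]) simp
  show "x \<in> P" if "breakpoint h x"
  proof (rule ccontr)
    assume "x \<notin> P"
    then obtain A where A: "A \<in> sl K" "den A x \<noteq> 0" "\<forall>\<^sub>F y in nhds x. h y = mob A y"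
      using PW(5) by (auto simp: germ_def)
    have "A \<in> sl \<real>" using A(1) by (simp add: sl_iff Reals_def)
    then obtain Q where Q: "Q \<in> carrier (PSL2 \<real>)" "mobius Q = mobius_mat A"
      using carrier_PSL2_I by blast
    have "\<forall>\<^sub>F y in nhds x. Some (h y) = mobius Q (Some y)"
      using A(3) eventually_den_nonzero [OF A(2) order_refl] by eventually_elim (simp add: Q mob_Some)
    then show False using that Q(1) unfolding breakpoint_def eventually_nhds by blast
  qed
qed

lemma (in subring_of_reals) piecewise_homeos_eq_PW:
  "{h \<in> piecewise_homeos (carrier (PSL2 K)). \<forall>x. breakpoint h x \<longrightarrow> x \<in> P} = PW K P"
  using piecewise_homeo_in_PW [of _ P] PW_piecewise_homeo [of _ P] by blast

section \<open>Invariable generation\<close>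

lemma (in breakpoint_set) group_G: "group (comp_group G)"
proof (rule groupI)
  fix f assume f: "f \<in> carrier (comp_group G)"
  then show "\<exists>g\<in>carrier (comp_group G). g \<otimes>\<^bsub>comp_group G\<^esub> f = \<one>\<^bsub>comp_group G\<^esub>"
    by (intro bexI [of _ "finv f"]) (auto simp: comp_group_def G_inv_mem fun_eq_iff)
qed (auto simp: comp_group_def G_comp id_G o_assoc)

lemma (in breakpoint_set) m_inv_G:
  assumes "f \<in> G" shows "inv\<^bsub>comp_group G\<^esub> f = finv f"
  by (rule group.inv_equality [OF group_G])
    (use assms G_inv_mem in \<open>auto simp: comp_group_def fun_eq_iff\<close>)

text \<open>The generated subgroup contains a conjugate of the translation by one. Conjugating the whole
  subgroup back by the same element reduces to the case in which it contains the translation.\<close>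

theorem (in bridged) invariably_generated_G: "invariably_generated (comp_group G)"
  unfolding invariably_generated_def
proof (intro conjI ballI)
  interpret group "comp_group G" by (rule group_G)
  have car: "carrier (comp_group G) = G" by (simp add: comp_group_def)
  have mult: "f \<otimes>\<^bsub>comp_group G\<^esub> g = f \<circ> g" for f g by (simp add: comp_group_def)
  have one: "\<one>\<^bsub>comp_group G\<^esub> = id" by (simp add: comp_group_def)
  show "group (comp_group G)" by (rule group_G)
  fix c assume c: "c \<in> carrier (comp_group G) \<rightarrow> carrier (comp_group G)"
  have cG: "c g \<in> G" if "g \<in> G" for g using c that by (auto simp: car)
  define S where "S = {c g \<otimes>\<^bsub>comp_group G\<^esub> g \<otimes>\<^bsub>comp_group G\<^esub> inv\<^bsub>comp_group G\<^esub> (c g) | g. g \<in> carrier (comp_group G)}"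
  define H where "H = generate (comp_group G) S"
  have S: "S = {c g \<circ> g \<circ> finv (c g) | g. g \<in> G}"
  proof -
    have "c g \<otimes>\<^bsub>comp_group G\<^esub> g \<otimes>\<^bsub>comp_group G\<^esub> inv\<^bsub>comp_group G\<^esub> (c g) = c g \<circ> g \<circ> finv (c g)"
      if "g \<in> G" for g
      by (simp only: mult m_inv_G [OF cG [OF that]])
    then have "(\<lambda>g. c g \<otimes>\<^bsub>comp_group G\<^esub> g \<otimes>\<^bsub>comp_group G\<^esub> inv\<^bsub>comp_group G\<^esub> (c g)) ` G =
        (\<lambda>g. c g \<circ> g \<circ> finv (c g)) ` G"
      by (rule image_cong [OF refl])
    then show ?thesis unfolding S_def car Setcompr_eq_image by simp
  qed
  have "c g \<circ> g \<circ> finv (c g) \<in> G" if "g \<in> G" for g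
    using G_comp [OF G_comp [OF cG [OF that] that] G_inv_mem [OF cG [OF that]]] .
  then have "S \<subseteq> carrier (comp_group G)"
    unfolding car S Setcompr_eq_image by (rule image_subsetI)
  then have sub: "subgroup H (comp_group G)"
    unfolding H_def by (rule generate_is_subgroup)
  have HG: "H \<subseteq> G" using subgroup.subset [OF sub] by (simp add: car)
  have H_comp: "f \<circ> g \<in> H" if "f \<in> H" "g \<in> H" for f g
    using subgroup.m_closed [OF sub that] by (simp add: mult)
  have H_inv: "finv f \<in> H" if "f \<in> H" for f
    using subgroup.m_inv_closed [OF sub that] m_inv_G that HG by auto
  have H_conj: "c g \<circ> g \<circ> finv (c g) \<in> H" if "g \<in> G" for g
    unfolding H_def S Setcompr_eq_image using that by (intro generate.incl imageI)
  define T :: "real \<Rightarrow> real" where "T = (\<lambda>x. x + 1)"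
  have T: "T \<in> G" unfolding T_def by (rule translation_G [OF K_1])
  define \<delta> where "\<delta> = c T"
  have \<delta>: "\<delta> \<in> G" using cG [OF T] by (simp add: \<delta>_def)
  define H' where "H' = {f \<in> G. \<delta> \<circ> f \<circ> finv \<delta> \<in> H}"
  interpret meets_conjugates K P H'
  proof unfold_locales
    show "H' \<subseteq> G" by (auto simp: H'_def)
    have "\<delta> \<circ> id \<circ> finv \<delta> = id" using \<delta> by auto
    then show "id \<in> H'" using id_G subgroup.one_closed [OF sub] by (simp add: H'_def one)
    show "f \<circ> g \<in> H'" if "f \<in> H'" "g \<in> H'" for f g
    proof -
      have "\<delta> \<circ> (f \<circ> g) \<circ> finv \<delta> = (\<delta> \<circ> f \<circ> finv \<delta>) \<circ> (\<delta> \<circ> g \<circ> finv \<delta>)"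
        using \<delta> by (auto simp: fun_eq_iff)
      then show ?thesis using that H_comp G_comp by (auto simp: H'_def)
    qed
    show "finv f \<in> H'" if f: "f \<in> H'" for f
    proof -
      have fG: "f \<in> G" using f by (simp add: H'_def)
      have "finv (\<delta> \<circ> f \<circ> finv \<delta>) = \<delta> \<circ> finv f \<circ> finv \<delta>"
        by (rule finv_eqI) (use \<delta> fG in auto)
      then show ?thesis using f H_inv G_inv_mem by (fastforce simp: H'_def)
    qed
    show "\<exists>\<gamma>\<in>G. \<gamma> \<circ> g \<circ> finv \<gamma> \<in> H'" if g: "g \<in> G" for g
    proof
      let ?\<gamma> = "finv \<delta> \<circ> c g"
      show \<gamma>: "?\<gamma> \<in> G" using \<delta> cG [OF g] by (intro G_comp G_inv_mem)
      have inv: "finv ?\<gamma> = finv (c g) \<circ> \<delta>"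
        by (rule finv_eqI) (use \<delta> cG [OF g] in auto)
      have "\<delta> \<circ> (?\<gamma> \<circ> g \<circ> finv ?\<gamma>) \<circ> finv \<delta> = c g \<circ> g \<circ> finv (c g)"
        unfolding inv using \<delta> by (auto simp: fun_eq_iff)
      then show "?\<gamma> \<circ> g \<circ> finv ?\<gamma> \<in> H'"
        using H_conj [OF g] G_comp [OF G_comp [OF \<gamma> g] G_inv_mem [OF \<gamma>]] by (simp only: H'_def mem_Collect_eq)
    qed
    show "(\<lambda>x. x + 1) \<in> H'"
      using H_conj [OF T] T by (simp add: H'_def \<delta>_def T_def)
  qed
  have "G \<subseteq> H"
  proof
    fix f assume f: "f \<in> G"
    have "finv \<delta> \<circ> f \<circ> \<delta> \<in> H'" unfolding H_eq_G using f \<delta> by (intro G_comp G_inv_mem)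
    moreover have "\<delta> \<circ> (finv \<delta> \<circ> f \<circ> \<delta>) \<circ> finv \<delta> = f" using \<delta> by (auto simp: fun_eq_iff)
    ultimately show "f \<in> H" by (simp add: H'_def)
  qed
  with HG have "H = carrier (comp_group G)" unfolding car by (rule subset_antisym)
  then show "generate (comp_group G) {c g \<otimes>\<^bsub>comp_group G\<^esub> g \<otimes>\<^bsub>comp_group G\<^esub> inv\<^bsub>comp_group G\<^esub> (c g) |g. g \<in> carrier (comp_group G)}
      = carrier (comp_group G)"
    by (simp only: H_def S_def)
qed

lemma bridged_field:
  assumes K: "subring_of_reals K" and inverse: "\<And>a. a \<in> K \<Longrightarrow> inverse a \<in> K" and rat: "\<rat> \<subseteq> K"
  shows "bridged K K"
proof -
  interpret subring_of_reals K by (rule K)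
  show ?thesis
  proof unfold_locales
    fix A x assume A: "A \<in> sl K" "x \<in> K"
    have "(A$1$1 * x + A$1$2) * inverse (den A x) \<in> K"
      unfolding den_def using A by (intro K_mult K_add inverse) (simp_all add: sl_iff)
    then show "mob A x \<in> K" by (simp add: mob_def divide_inverse)
  qed (rule bridge_field [OF inverse rat])
qed

text \<open>If \<open>M\<close> fixes \<open>x\<close>, then \<open>A M A\<inverse>\<close> fixes the image of \<open>x\<close> and has the same trace.\<close>

lemma P_Z_mob:
  assumes A: "A \<in> sl \<int>" "den A x \<noteq> 0" and x: "x \<in> P_Z"
  shows "mob A x \<in> P_Z"
proof -
  obtain M where M: "M \<in> sl \<int>" "\<bar>trace M\<bar> > 2" "den M x \<noteq> 0" "mob M x = x"
    using P_Z_E [OF x] by blast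
  have d: "den (adj A) (mob A x) \<noteq> 0" "mob (adj A) (mob A x) = x"
    using den_adj_mob [OF A] mob_adj_mob [OF A] by auto
  then have d': "den (M ** adj A) (mob A x) \<noteq> 0" "mob (M ** adj A) (mob A x) = x"
    using M by (simp_all add: den_mult mob_mult)
  have "adj A ** A = mat 1"
    using A(1) by (simp add: vec_eq_iff forall_2 matrix_mult_nth_2 adj_def mat_def sl_iff algebra_simps)
  then have "trace (A ** (M ** adj A)) = trace M"
    by (metis trace_mul_sym matrix_mul_assoc matrix_mul_rid)
  moreover have "A ** (M ** adj A) \<in> sl \<int>"
    using A(1) M(1) by (intro ints.sl_mult ints.sl_adj)
  ultimately show ?thesis
    using d' M(2) A(2) by (intro P_Z_I [of "A ** (M ** adj A)"]) (simp_all add: den_mult mob_mult)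
qed

lemma bridged_int:
  assumes "P_Z \<subseteq> P" and "\<And>A x. A \<in> sl \<int> \<Longrightarrow> x \<in> P \<Longrightarrow> den A x \<noteq> 0 \<Longrightarrow> mob A x \<in> P"
  shows "bridged \<int> P"
proof unfold_locales
  fix A B :: "real^2^2" and x y \<delta> :: real
  assume "A \<in> sl \<int>" "B \<in> sl \<int>" "x < y" "den A x \<noteq> 0" "den B y \<noteq> 0" "mob A x < mob B y" "0 < \<delta>"
  then show "\<exists>C\<in>sl \<int>. \<exists>u\<in>P. \<exists>v\<in>P. x < u \<and> u < x + \<delta> \<and> y - \<delta> < v \<and> v < y \<and> u < v \<and>
        C$2$1 > 0 \<and> den C u > 0 \<and> mob C u = mob A u \<and> mob C v = mob B v"
    using bridge_int [of A x B y \<delta>] assms(1) by (meson subsetD)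
qed (rule assms(2))

theorem theorem1p1:
  shows "invariably_generated PP_plus \<and>
         invariably_generated PPSL2_Z \<and>
         invariably_generated Monod_H_Z \<and>
         invariably_generated PPSL2_Q_rational_breaks"
proof -
  have subrings: "subring_of_reals \<real>" "subring_of_reals \<int>" "subring_of_reals \<rat>"
    by unfold_locales auto
  have UNIV: "\<real> = (UNIV :: real set)" by (simp add: Reals_def)
  note eq = subring_of_reals.piecewise_homeos_eq_PW
  have "PP_plus = comp_group (PW \<real> \<real>)"
    using eq [OF subrings(1), of \<real>] by (simp add: PP_plus_def UNIV)
  moreover have "bridged \<real> \<real>"
    by (rule bridged_field [OF subrings(1)]) (simp_all add: UNIV)
  ultimately have 1: "invariably_generated PP_plus"
    using bridged.invariably_generated_G by metis
  have "PPSL2_Z = comp_group (PW \<int> UNIV)"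
    using eq [OF subrings(2), of UNIV] by (simp add: PPSL2_Z_def)
  moreover have "bridged \<int> UNIV"
    by (rule bridged_int) simp_all
  ultimately have 2: "invariably_generated PPSL2_Z"
    using bridged.invariably_generated_G by metis
  have "Monod_H_Z = comp_group (PW \<int> P_Z)"
    using eq [OF subrings(2), of P_Z] by (simp add: Monod_H_Z_def)
  moreover have "bridged \<int> P_Z"
    using P_Z_mob by (intro bridged_int) auto
  ultimately have 3: "invariably_generated Monod_H_Z"
    using bridged.invariably_generated_G by metis
  have "PPSL2_Q_rational_breaks = comp_group (PW \<rat> \<rat>)"
    using eq [OF subrings(3), of \<rat>] by (simp add: PPSL2_Q_rational_breaks_def)
  moreover have "bridged \<rat> \<rat>"
    by (rule bridged_field [OF subrings(3)]) auto
  ultimately have 4: "invariably_generated PPSL2_Q_rational_breaks"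
    using bridged.invariably_generated_G by metis
  from 1 2 3 4 show ?thesis by blast
qed

end
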